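(* Let $\mathbbm{k}$ be a field of characteristic $0$, $N \geqslant 3$, and let $I$ be the defining ideal of a general set of $s$ points in $\mathbb{P}^N_{\mathbbm{k}}$ (for any $s \geqslant 1$). Then for all $m \in \mathbb{N}$, $$\frac{\alpha(I^{(m)})}{m} \geqslant \frac{\alpha(I)+N-2}{N}.$$
   Context: $\alpha(J)$ is the least degree of a nonzero homogeneous element of a homogeneous ideal $J$. For the ideal $I$ of points with point ideals $\mathfrak{p}_1,\dots,\mathfrak{p}_s$, $I^{(m)} = \bigcap_i \mathfrak{p}_i^m$. A property holds for a general set of $s$ points in $\mathbb{P}^N_{\mathbbm{k}}$ if there is a nonempty Zariski open subset $U$ of the parameter space of $s$ points (e.g. of $\mathbb{A}^{s(N+1)}_{\mathbbm{k}}$, with $\mathbf{a}=(a_{ij})$ giving the points $[a_{i0}:\dots:a_{iN}]$) such that the property holds for every set of points corresponding to a point of $U$. *)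

theory Defs
  imports Complex_Main "HOL-Library.Poly_Mapping"
begin

type_synonym ('v, 'k) mpoly = "('v \<Rightarrow>\<^sub>0 nat) \<Rightarrow>\<^sub>0 'k"

definition Var :: "'v \<Rightarrow> ('v, 'k::comm_ring_1) mpoly" where
  "Var v = Poly_Mapping.single (Poly_Mapping.single v 1) 1"

definition Const :: "'k::comm_ring_1 \<Rightarrow> ('v, 'k) mpoly" where
  "Const c = Poly_Mapping.single 0 c"

definition mpoly_eval :: "('v, 'k::comm_ring_1) mpoly \<Rightarrow> ('v \<Rightarrow> 'k) \<Rightarrow> 'k" where
  "mpoly_eval p a =
     (\<Sum>mon\<in>Poly_Mapping.keys p. Poly_Mapping.lookup p mon * (\<Prod>v\<in>Poly_Mapping.keys mon. a v ^ Poly_Mapping.lookup mon v))"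

definition polyring :: "nat \<Rightarrow> (nat, 'k::comm_ring_1) mpoly set" where
  "polyring N = {f. \<forall>mon\<in>Poly_Mapping.keys f. Poly_Mapping.keys mon \<subseteq> {..N}}"

definition homogeneous :: "nat \<Rightarrow> ('v, 'k::comm_ring_1) mpoly \<Rightarrow> bool" where
  "homogeneous d f \<longleftrightarrow> (\<forall>mon\<in>Poly_Mapping.keys f. (\<Sum>v\<in>Poly_Mapping.keys mon. Poly_Mapping.lookup mon v) = d)"

definition ideal_span :: "nat \<Rightarrow> (nat, 'k::comm_ring_1) mpoly set \<Rightarrow> (nat, 'k) mpoly set" where
  "ideal_span N S = {(\<Sum>g\<in>F. r g * g) | F r. finite F \<and> F \<subseteq> S \<and> (\<forall>g\<in>F. r g \<in> polyring N)}"

definition ideal_pow :: "nat \<Rightarrow> (nat, 'k::comm_ring_1) mpoly set \<Rightarrow> nat \<Rightarrow> (nat, 'k) mpoly set" where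
  "ideal_pow N J m = ideal_span N {prod_list gs | gs. length gs = m \<and> set gs \<subseteq> J}"

text \<open>Ideal of the point [p_0 : ... : p_N] of P^N: generated by the 2x2 minors p_j x_k - p_k x_j.\<close>
definition point_ideal :: "nat \<Rightarrow> (nat \<Rightarrow> 'k::comm_ring_1) \<Rightarrow> (nat, 'k) mpoly set" where
  "point_ideal N p = ideal_span N
     {Const (p j) * Var k - Const (p k) * Var j | j k. j \<le> N \<and> k \<le> N}"

definition points_ideal :: "nat \<Rightarrow> nat \<Rightarrow> (nat \<times> nat \<Rightarrow> 'k::comm_ring_1) \<Rightarrow> (nat, 'k) mpoly set" where
  "points_ideal N s a = (\<Inter>i<s. point_ideal N (\<lambda>j. a (i, j)))"

definition symbolic_power :: "nat \<Rightarrow> nat \<Rightarrow> (nat \<times> nat \<Rightarrow> 'k::comm_ring_1) \<Rightarrow> nat \<Rightarrow> (nat, 'k) mpoly set" where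
  "symbolic_power N s a m = (\<Inter>i<s. ideal_pow N (point_ideal N (\<lambda>j. a (i, j))) m)"

definition alpha :: "(nat, 'k::comm_ring_1) mpoly set \<Rightarrow> nat" where
  "alpha J = (LEAST d. \<exists>f\<in>J. f \<noteq> 0 \<and> homogeneous d f)"

text \<open>Zariski open subsets of the parameter space A^{s(N+1)}, coordinates (i,j), i<s, j<=N.\<close>
definition param_zariski_open :: "nat \<Rightarrow> nat \<Rightarrow> (nat \<times> nat \<Rightarrow> 'k::comm_ring_1) set \<Rightarrow> bool" where
  "param_zariski_open N s U \<longleftrightarrow>
     (\<exists>P :: (nat \<times> nat, 'k) mpoly set.
        (\<forall>p\<in>P. \<forall>mon\<in>Poly_Mapping.keys p. Poly_Mapping.keys mon \<subseteq> {..<s} \<times> {..N}) \<and>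
        U = {a. \<exists>p\<in>P. mpoly_eval p a \<noteq> 0})"

end

theory Submission
  imports Defs "HOL-Computational_Algebra.Primes" "HOL-Computational_Algebra.Polynomial"
begin

text \<open>
  Choose \<open>d\<close> with \<open>(N + d - 1) choose N \<le> s < (N + d) choose N\<close> and put \<open>L = N + d - 1\<close>. Counting
  monomials gives \<open>\<alpha>(I) \<le> d\<close>. The points where \<open>N\<close> of \<open>L\<close> hyperplanes in general position meet form
  a star configuration of at most \<open>s\<close> points, and restricting to the hyperplanes shows that a form
  of degree \<open>e\<close> vanishing to order \<open>m\<close> on it satisfies \<open>N e \<ge> m L\<close>. By semicontinuity, for the
  single order \<open>N L\<close>, general points have \<open>\<alpha>(I\<^sup>(\<^sup>N\<^sup>L\<^sup>)) \<ge> L\<^sup>2\<close>, and one open set serves this order.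

  To pass from this one order to all \<open>m\<close>, reduce modulo a large prime \<open>p\<close>. If \<open>f\<close> has degree \<open>e\<close> and
  vanishes to order \<open>m\<close>, take \<open>k\<close> with \<open>k m\<close> just above \<open>p (N + N L)\<close> and write
  \<open>f\<^sup>k = (\<Sum>b. x\<^sup>b h\<^sub>b(x\<^sup>p))\<close> with all exponents of \<open>b\<close> below \<open>p\<close>. By the pigeonhole principle each
  \<open>h\<^sub>b\<close> vanishes modulo \<open>p\<close> to order \<open>N L\<close> at the points with coordinates raised to the \<open>p\<close>-th power,
  which are again general; its degree is at most \<open>k e / p\<close>, so \<open>h\<^sub>b\<close> would vanish modulo \<open>p\<close> if
  \<open>e (N + N L) < m L\<^sup>2\<close>. Then all large primes would be units in a finitely generated subring of
  a domain of characteristic \<open>0\<close>, which is impossible. Hence \<open>e / m \<ge> L\<^sup>2 / (N + N L) \<ge> (L - 1) / N\<close>.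
\<close>

hide_const (open) Poly_Mapping.degree

abbreviation lookup where "lookup \<equiv> Poly_Mapping.lookup"
abbreviation keys where "keys \<equiv> Poly_Mapping.keys"
abbreviation single where "single \<equiv> Poly_Mapping.single"

section \<open>Decomposition of polynomials into single terms\<close>

lemma mpoly_sum_singles:
  fixes f :: "'a \<Rightarrow>\<^sub>0 'b::comm_monoid_add"
  shows "(\<Sum>m\<in>keys f. single m (lookup f m)) = f"
proof (rule poly_mapping_eqI)
  fix k
  have "lookup (\<Sum>m\<in>keys f. single m (lookup f m)) k = (\<Sum>m\<in>keys f. if m = k then lookup f m else 0)"
    by (simp add: lookup_sum lookup_single when_def)
  also have "\<dots> = lookup f k" by (simp add: in_keys_iff)
  finally show "lookup (\<Sum>m\<in>keys f. single m (lookup f m)) k = lookup f k" .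
qed

lemma mpoly_induct [case_names single add]:
  fixes f :: "'a \<Rightarrow>\<^sub>0 'b::comm_monoid_add"
  assumes "\<And>m c. P (single m c)" and "\<And>f g. P f \<Longrightarrow> P g \<Longrightarrow> P (f + g)"
  shows "P f"
proof -
  have "P (\<Sum>m\<in>M. single m (lookup f m))" if "finite M" for M
    using that
  proof induction
    case empty
    show ?case using assms(1)[of undefined 0] by simp
  qed (simp add: assms)
  then show ?thesis by (metis mpoly_sum_singles finite_keys)
qed

text \<open>Only terms occurring in \<open>f\<close> have to be treated, so that facts about all
  keys of \<open>f\<close>, such as homogeneity, can be used for each of them.\<close>

lemma mpoly_induct_subset:
  fixes f :: "'a \<Rightarrow>\<^sub>0 'b::comm_monoid_add"
  assumes "\<And>m. m \<in> keys f \<Longrightarrow> P (single m (lookup f m))"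
    and "P 0" and "\<And>f g. P f \<Longrightarrow> P g \<Longrightarrow> P (f + g)"
  shows "P f"
proof -
  have "P (\<Sum>m\<in>M. single m (lookup f m))" if "finite M" "M \<subseteq> keys f" for M
    using that by induction (simp_all add: assms)
  then show ?thesis by (metis mpoly_sum_singles finite_keys subset_refl)
qed

lemma keys_add_nat: "keys (m + n) = keys m \<union> keys (n :: 'v \<Rightarrow>\<^sub>0 nat)"
  by (auto simp: in_keys_iff lookup_add)

subsection \<open>Monomials and substitution\<close>

definition mdeg :: "('v \<Rightarrow>\<^sub>0 nat) \<Rightarrow> nat" where
  "mdeg m = (\<Sum>v\<in>keys m. lookup m v)"

definition mon :: "('v \<Rightarrow> 'r::comm_monoid_mult) \<Rightarrow> ('v \<Rightarrow>\<^sub>0 nat) \<Rightarrow> 'r" where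
  "mon x m = (\<Prod>v\<in>keys m. x v ^ lookup m v)"

lemma mdeg_superset: "finite V \<Longrightarrow> keys m \<subseteq> V \<Longrightarrow> mdeg m = (\<Sum>v\<in>V. lookup m v)"
  unfolding mdeg_def by (rule sum.mono_neutral_left) (auto simp: in_keys_iff)

lemma mon_superset: "finite V \<Longrightarrow> keys m \<subseteq> V \<Longrightarrow> mon x m = (\<Prod>v\<in>V. x v ^ lookup m v)"
  unfolding mon_def by (rule prod.mono_neutral_left) (auto simp: in_keys_iff)

lemma mdeg_add [simp]: "mdeg (m + n) = mdeg m + mdeg n"
proof -
  let ?V = "keys m \<union> keys n"
  have "mdeg (m + n) = (\<Sum>v\<in>?V. lookup (m + n) v)"
    by (intro mdeg_superset) (auto simp: keys_add_nat)
  moreover have "mdeg m = (\<Sum>v\<in>?V. lookup m v)" "mdeg n = (\<Sum>v\<in>?V. lookup n v)"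
    by (auto intro: mdeg_superset)
  ultimately show ?thesis
    by (simp add: lookup_add sum.distrib)
qed

lemma mon_add [simp]: "mon x (m + n) = mon x m * mon x n"
proof -
  let ?V = "keys m \<union> keys n"
  have "mon x (m + n) = (\<Prod>v\<in>?V. x v ^ lookup (m + n) v)"
    by (intro mon_superset) (auto simp: keys_add_nat)
  moreover have "mon x m = (\<Prod>v\<in>?V. x v ^ lookup m v)" "mon x n = (\<Prod>v\<in>?V. x v ^ lookup n v)"
    by (auto intro: mon_superset)
  ultimately show ?thesis
    by (simp add: lookup_add power_add prod.distrib)
qed

lemma mdeg_zero [simp]: "mdeg 0 = 0" by (simp add: mdeg_def)
lemma mon_zero [simp]: "mon x 0 = 1" by (simp add: mon_def)
lemma mdeg_single [simp]: "mdeg (single v n) = n" by (simp add: mdeg_def)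
lemma mon_single [simp]: "mon x (single v n) = x v ^ n" by (simp add: mon_def)

lemma lookup_le_mdeg: "lookup m v \<le> mdeg m"
  using mdeg_superset[of "insert v (keys m)" m, OF _ subset_insertI] by (simp add: sum.insert_remove)

lemma mdeg_eq_0_iff [simp]: "mdeg m = 0 \<longleftrightarrow> m = 0"
proof
  assume "mdeg m = 0"
  then have "lookup m v = lookup 0 v" for v
    using lookup_le_mdeg[of m v] by simp
  then show "m = 0" by (rule poly_mapping_eqI)
qed simp

lemma monomial_cases:
  fixes m :: "'v \<Rightarrow>\<^sub>0 nat"
  obtains "m = 0" | v n where "m = single v 1 + n" "v \<in> keys m" "keys n \<subseteq> keys m" "mdeg m = Suc (mdeg n)"
proof (cases "m = 0")
  case False
  then obtain v where v: "v \<in> keys m"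
    by (auto simp: poly_mapping_eq_iff fun_eq_iff in_keys_iff)
  have eq: "m = single v 1 + (m - single v 1)"
    using v by (intro poly_mapping_eqI) (auto simp: lookup_add lookup_minus lookup_single when_def in_keys_iff)
  have "keys (m - single v 1) \<subseteq> keys m"
    by (auto simp: in_keys_iff lookup_minus)
  moreover have "mdeg m = Suc (mdeg (m - single v 1))"
    using arg_cong[OF eq, of mdeg] by (simp only: mdeg_add mdeg_single)
  ultimately show ?thesis using that(2)[OF eq v] by blast
qed blast

lemma monomial_induct [case_names zero add]:
  fixes m :: "'v \<Rightarrow>\<^sub>0 nat"
  assumes "P 0" and "\<And>v n. P n \<Longrightarrow> P (single v 1 + n)"
  shows "P m"
proof (induction "mdeg m" arbitrary: m)
  case 0
  then show ?case using assms(1) by simp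
next
  case (Suc k)
  show ?case
    by (cases m rule: monomial_cases) (use Suc assms in auto)
qed

lemma monomial_induct_in [consumes 1, case_names zero add]:
  fixes m :: "'v \<Rightarrow>\<^sub>0 nat"
  assumes "keys m \<subseteq> V" and "P 0"
    and "\<And>v n. v \<in> V \<Longrightarrow> keys n \<subseteq> V \<Longrightarrow> P n \<Longrightarrow> P (single v 1 + n)"
  shows "P m"
  using assms(1)
proof (induction m rule: monomial_induct)
  case (add v n)
  then show ?case using assms(3)[of v n] by (simp add: keys_add_nat)
qed (rule assms)

lemma Const_0 [simp]: "Const 0 = 0" by (simp add: Const_def)
lemma Const_1 [simp]: "Const 1 = 1" by (simp add: Const_def)
lemma Const_add: "Const (a + b) = Const a + Const b" by (simp add: Const_def single_add)
lemma Const_diff: "Const (a - b) = Const a - Const b" by (simp add: Const_def single_diff)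
lemma Const_mult: "Const (a * b) = Const a * Const b" by (simp add: Const_def mult_single)
lemma Const_power: "Const (a ^ n) = Const a ^ n" by (induction n) (simp_all add: Const_mult)
lemma Const_sum: "Const (sum f X) = (\<Sum>x\<in>X. Const (f x))"
  by (induction X rule: infinite_finite_induct) (simp_all add: Const_add)
lemma Const_of_nat: "Const (of_nat n) = of_nat n" by (simp add: Const_def)
lemma Const_eq_iff [simp]: "Const a = Const b \<longleftrightarrow> a = b" by (simp add: Const_def inj_eq)
lemma Const_eq_0_iff [simp]: "Const a = 0 \<longleftrightarrow> a = 0" using Const_eq_iff[of a 0] by simp

lemma lookup_single_mult: "lookup (single u c * g) (u + m) = c * lookup g (m :: 'v \<Rightarrow>\<^sub>0 nat)"
  by (induction g rule: mpoly_induct)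
    (simp_all add: mult_single lookup_single when_def lookup_add distrib_left)

lemma lookup_single_mult_0:
  "(\<And>m'. m \<noteq> u + m') \<Longrightarrow> lookup (single u c * g) (m :: 'v \<Rightarrow>\<^sub>0 nat) = 0"
  by (induction g rule: mpoly_induct)
    (auto simp add: mult_single lookup_single when_def lookup_add distrib_left)

lemma lookup_Const_mult [simp]: "lookup (Const c * g) m = c * lookup g (m :: 'v \<Rightarrow>\<^sub>0 nat)"
  using lookup_single_mult[of 0 c g m] by (simp add: Const_def)

lemma single_eq_Const_mon: "single m c = Const c * mon Var (m :: 'v \<Rightarrow>\<^sub>0 nat)"
proof (induction m rule: monomial_induct)
  case (add v n)
  have "single (single v 1 + n) c = Var v * single n c"
    by (simp add: Var_def mult_single)
  then show ?case using add by (simp add: algebra_simps)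
qed (simp add: Const_def)

text \<open>The algebra homomorphism determined by the images of the variables. Evaluation,
  translation, restriction to a hyperplane and raising the variables to the power \<open>p\<close>
  are all instances.\<close>

definition subst :: "('v \<Rightarrow> ('w, 'k::comm_ring_1) mpoly) \<Rightarrow> ('v, 'k) mpoly \<Rightarrow> ('w, 'k) mpoly" where
  "subst x f = (\<Sum>m\<in>keys f. Const (lookup f m) * mon x m)"

lemma subst_superset:
  "finite M \<Longrightarrow> keys f \<subseteq> M \<Longrightarrow> subst x f = (\<Sum>m\<in>M. Const (lookup f m) * mon x m)"
  unfolding subst_def by (rule sum.mono_neutral_left) (auto simp: in_keys_iff)

lemma subst_single: "subst x (single m c) = Const c * mon x m"
  by (simp add: subst_def)

lemma subst_Const [simp]: "subst x (Const c) = Const c"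
  using subst_single[of x 0 c] by (simp add: Const_def)

lemma subst_Var [simp]: "subst x (Var v) = x v"
  by (simp add: Var_def subst_single)

lemma subst_add [simp]: "subst x (f + g) = subst x f + subst x g"
proof -
  let ?M = "keys f \<union> keys g"
  have "subst x (f + g) = (\<Sum>m\<in>?M. Const (lookup (f + g) m) * mon x m)"
    by (intro subst_superset) (auto dest: subsetD[OF keys_add])
  moreover have "subst x f = (\<Sum>m\<in>?M. Const (lookup f m) * mon x m)"
    "subst x g = (\<Sum>m\<in>?M. Const (lookup g m) * mon x m)"
    by (auto intro: subst_superset)
  ultimately show ?thesis
    by (simp add: lookup_add Const_add distrib_right sum.distrib)
qed

lemma subst_0 [simp]: "subst x 0 = 0" using subst_Const[of x 0] by simp
lemma subst_1 [simp]: "subst x 1 = 1" using subst_Const[of x 1] by simp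

lemma subst_mult [simp]: "subst x (f * g) = subst x f * subst x g"
proof (induction f rule: mpoly_induct)
  case (single m c)
  show ?case
    by (induction g rule: mpoly_induct) (simp_all add: mult_single subst_single Const_mult algebra_simps)
qed (simp add: distrib_right)

lemma subst_uminus [simp]: "subst x (- f) = - subst x f"
  using subst_add[of x f "- f"] by (simp add: eq_neg_iff_add_eq_0 add.commute)

lemma subst_diff [simp]: "subst x (f - g) = subst x f - subst x g"
  using subst_add[of x f "- g"] by simp

lemma subst_sum [simp]: "subst x (sum f X) = (\<Sum>i\<in>X. subst x (f i))"
  by (induction X rule: infinite_finite_induct) simp_all

lemma subst_prod [simp]: "subst x (prod f X) = (\<Prod>i\<in>X. subst x (f i))"
  by (induction X rule: infinite_finite_induct) simp_all

lemma subst_power [simp]: "subst x (f ^ n) = subst x f ^ n"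
  by (induction n) simp_all

lemma subst_mon: "subst x (mon y m) = mon (\<lambda>v. subst x (y v)) m"
  by (simp add: mon_def)

lemma subst_subst: "subst x (subst y f) = subst (\<lambda>v. subst x (y v)) f"
  by (simp add: subst_def[of y] subst_def[of "\<lambda>v. subst x (y v)"] subst_mon)

lemma subst_Var_id [simp]: "subst Var f = f"
  by (induction f rule: mpoly_induct) (simp_all add: subst_mon single_eq_Const_mon)

lemma mon_cong: "(\<And>v. v \<in> keys m \<Longrightarrow> x v = y v) \<Longrightarrow> mon x m = mon y m"
  by (simp add: mon_def)

lemma subst_cong:
  assumes "\<And>m v. m \<in> keys f \<Longrightarrow> v \<in> keys m \<Longrightarrow> x v = y v"
  shows "subst x f = subst y f"
  unfolding subst_def using assms by (intro sum.cong refl arg_cong2[where f = "(*)"] mon_cong) auto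

lemma subst_polyring_cong: "f \<in> polyring N \<Longrightarrow> (\<And>v. v \<le> N \<Longrightarrow> x v = y v) \<Longrightarrow> subst x f = subst y f"
  by (rule subst_cong) (auto simp: polyring_def)

lemma mon_Const: "mon (\<lambda>v. Const (a v)) m = Const (mon a m)"
  by (induction m rule: monomial_induct) (simp_all add: Const_mult)

text \<open>As \<open>Const\<close> is injective, the rules for \<open>mpoly_eval\<close> can be
  read off from those for \<open>subst\<close>.\<close>

lemma Const_mpoly_eval: "Const (mpoly_eval f a) = subst (\<lambda>v. Const (a v)) f"
proof -
  have "mpoly_eval f a = (\<Sum>m\<in>keys f. lookup f m * mon a m)"
    by (simp add: mpoly_eval_def mon_def)
  then show ?thesis
    by (simp add: subst_def Const_sum Const_mult mon_Const)
qed

lemma mpoly_eval_Const [simp]: "mpoly_eval (Const c) a = c"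
  using Const_mpoly_eval[of "Const c" a] by simp
lemma mpoly_eval_Var [simp]: "mpoly_eval (Var v) a = a v"
  using Const_mpoly_eval[of "Var v" a] by simp
lemma mpoly_eval_mult [simp]: "mpoly_eval (f * g) a = mpoly_eval f a * mpoly_eval g a"
  by (subst Const_eq_iff[symmetric]) (simp add: Const_mpoly_eval Const_mult)
lemma mpoly_eval_add [simp]: "mpoly_eval (f + g) a = mpoly_eval f a + mpoly_eval g a"
  by (subst Const_eq_iff[symmetric]) (simp add: Const_mpoly_eval Const_add)
lemma mpoly_eval_diff [simp]: "mpoly_eval (f - g) a = mpoly_eval f a - mpoly_eval g a"
  by (subst Const_eq_iff[symmetric]) (simp add: Const_mpoly_eval Const_diff)

subsection \<open>Subrings and coefficients\<close>

definition is_subring :: "'r::comm_ring_1 set \<Rightarrow> bool" where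
  "is_subring A \<longleftrightarrow> 1 \<in> A \<and> (\<forall>x\<in>A. \<forall>y\<in>A. x - y \<in> A \<and> x * y \<in> A)"

lemma
  assumes "is_subring A"
  shows subring_1: "1 \<in> A" and subring_diff: "x \<in> A \<Longrightarrow> y \<in> A \<Longrightarrow> x - y \<in> A"
    and subring_mult: "x \<in> A \<Longrightarrow> y \<in> A \<Longrightarrow> x * y \<in> A"
  using assms by (auto simp: is_subring_def)

lemma subring_0: "is_subring A \<Longrightarrow> 0 \<in> A"
  by (force simp: is_subring_def)

lemma subring_uminus: "is_subring A \<Longrightarrow> x \<in> A \<Longrightarrow> - x \<in> A"
  by (frule subring_0, drule (2) subring_diff[where x = 0]) simp

lemma subring_add: "is_subring A \<Longrightarrow> x \<in> A \<Longrightarrow> y \<in> A \<Longrightarrow> x + y \<in> A"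
  by (frule (1) subring_uminus[where x = y], drule (2) subring_diff) simp

lemma subring_sum: "is_subring A \<Longrightarrow> (\<And>i. i \<in> X \<Longrightarrow> f i \<in> A) \<Longrightarrow> sum f X \<in> A"
  by (induction X rule: infinite_finite_induct) (simp_all add: subring_0 subring_add)

lemma subring_prod: "is_subring A \<Longrightarrow> (\<And>i. i \<in> X \<Longrightarrow> f i \<in> A) \<Longrightarrow> prod f X \<in> A"
  by (induction X rule: infinite_finite_induct) (simp_all add: subring_1 subring_mult)

lemma subring_power: "is_subring A \<Longrightarrow> x \<in> A \<Longrightarrow> x ^ n \<in> A"
  by (induction n) (simp_all add: subring_1 subring_mult)

lemma subring_of_nat: "is_subring A \<Longrightarrow> of_nat n \<in> A"
  by (induction n) (simp_all add: subring_0 subring_1 subring_add)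

definition coeffs_in :: "'k::comm_ring_1 set \<Rightarrow> ('v, 'k) mpoly set" where
  "coeffs_in A = {f. \<forall>m. lookup f m \<in> A}"

lemma coeffs_in_subring:
  assumes A: "is_subring A"
  shows "is_subring (coeffs_in A :: ('v, 'k::comm_ring_1) mpoly set)"
proof -
  have single: "single m c \<in> coeffs_in A" if "c \<in> A" for m :: "'v \<Rightarrow>\<^sub>0 nat" and c
    using that A by (auto simp: coeffs_in_def lookup_single when_def subring_0)
  have "f * g \<in> coeffs_in A" if "f \<in> coeffs_in A" "g \<in> coeffs_in A" for f g :: "('v, 'k) mpoly"
  proof -
    have sum: "sum h X \<in> coeffs_in A" if "\<And>i. i \<in> X \<Longrightarrow> h i \<in> coeffs_in A" for h :: "_ \<Rightarrow> ('v, 'k) mpoly" and X :: "('v \<Rightarrow>\<^sub>0 nat) set"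
      using that A by (auto simp: coeffs_in_def lookup_sum intro!: subring_sum)
    have "f * g = (\<Sum>m\<in>keys f. single m (lookup f m)) * (\<Sum>m\<in>keys g. single m (lookup g m))"
      by (simp add: mpoly_sum_singles)
    also have "\<dots> = (\<Sum>m\<in>keys f. \<Sum>n\<in>keys g. single (m + n) (lookup f m * lookup g n))"
      by (simp add: sum_product mult_single)
    also have "\<dots> \<in> coeffs_in A"
      using that A by (intro sum single) (auto simp: coeffs_in_def intro: subring_mult)
    finally show ?thesis .
  qed
  moreover have "1 \<in> (coeffs_in A :: ('v, 'k) mpoly set)"
    using single[of 1 0] A by (simp add: subring_1)
  ultimately show ?thesis
    using A by (auto simp: is_subring_def) (auto simp: coeffs_in_def lookup_minus is_subring_def)
qed

lemma Const_in_coeffs_in: "is_subring A \<Longrightarrow> c \<in> A \<Longrightarrow> Const c \<in> coeffs_in A"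
  by (auto simp: coeffs_in_def Const_def lookup_single when_def subring_0)

lemma Var_in_coeffs_in: "is_subring A \<Longrightarrow> Var v \<in> coeffs_in A"
  by (auto simp: coeffs_in_def Var_def lookup_single when_def subring_0 subring_1)

lemma subring_mon: "is_subring A \<Longrightarrow> (\<And>v. v \<in> keys m \<Longrightarrow> x v \<in> A) \<Longrightarrow> mon x m \<in> A"
  unfolding mon_def by (intro subring_prod subring_power) auto

lemma subst_in_coeffs_in:
  assumes A: "is_subring A" and f: "f \<in> coeffs_in A" and x: "\<And>v. x v \<in> coeffs_in A"
  shows "subst x f \<in> coeffs_in A"
proof -
  note R = coeffs_in_subring[OF A]
  have "Const (lookup f m) * mon x m \<in> coeffs_in A" for m
    using f by (intro subring_mult[OF R] Const_in_coeffs_in A subring_mon[OF R] x) (simp add: coeffs_in_def)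
  then show ?thesis unfolding subst_def by (intro subring_sum[OF R])
qed

subsection \<open>Homogeneous components and order of vanishing\<close>

lemma homogeneous_iff: "homogeneous d f \<longleftrightarrow> (\<forall>m\<in>keys f. mdeg m = d)"
  by (simp add: homogeneous_def mdeg_def)

definition hcomp :: "nat \<Rightarrow> ('v, 'k::comm_ring_1) mpoly \<Rightarrow> ('v, 'k) mpoly" where
  "hcomp r f = Abs_poly_mapping (\<lambda>m. lookup f m when mdeg m = r)"

lemma lookup_hcomp: "lookup (hcomp r f) m = (lookup f m when mdeg m = r)"
proof -
  have "finite {m. (lookup f m when mdeg m = r) \<noteq> 0}"
    by (rule finite_subset[OF _ finite_keys[of f]]) (auto simp: in_keys_iff)
  then show ?thesis by (simp add: hcomp_def)
qed

lemma hcomp_add [simp]: "hcomp r (f + g) = hcomp r f + hcomp r g"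
  by (rule poly_mapping_eqI) (simp add: lookup_hcomp lookup_add when_def)

lemma hcomp_0 [simp]: "hcomp r 0 = 0"
  by (rule poly_mapping_eqI) (simp add: lookup_hcomp)

lemma hcomp_single: "hcomp r (single m c) = (if mdeg m = r then single m c else 0)"
  by (rule poly_mapping_eqI) (auto simp: lookup_hcomp lookup_single when_def)

lemma hcomp_Const_mult: "hcomp r (Const c * f) = Const c * hcomp r f"
  by (rule poly_mapping_eqI) (simp add: lookup_hcomp when_def)

lemma homogeneous_hcomp: "homogeneous r (hcomp r f)"
  by (auto simp: homogeneous_iff in_keys_iff lookup_hcomp)

lemma hcomp_homogeneous: "homogeneous d f \<Longrightarrow> hcomp r f = (if r = d then f else 0)"
proof (rule poly_mapping_eqI)
  fix m
  assume "homogeneous d f"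
  then have "lookup f m = 0 \<or> mdeg m = d" by (auto simp: homogeneous_iff in_keys_iff)
  then show "lookup (hcomp r f) m = lookup (if r = d then f else 0) m"
    by (auto simp: lookup_hcomp)
qed

lemma homogeneous_0 [simp]: "homogeneous d 0"
  by (simp add: homogeneous_iff)

lemma homogeneous_Var: "homogeneous 1 (Var v)"
  by (simp add: homogeneous_iff Var_def)

lemma homogeneous_add: "homogeneous d f \<Longrightarrow> homogeneous d g \<Longrightarrow> homogeneous d (f + g)"
  unfolding homogeneous_iff using keys_add[of f g] by blast

lemma homogeneous_mult:
  "homogeneous d f \<Longrightarrow> homogeneous e g \<Longrightarrow> homogeneous (d + e) (f * g)"
  unfolding homogeneous_iff using keys_mult[of f g] by (fastforce simp del: lookup_eq_zero_in_keys_contradict)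

lemma homogeneous_Const_mult: "homogeneous d f \<Longrightarrow> homogeneous d (Const c * f)"
  by (auto simp: homogeneous_iff in_keys_iff)

lemma homogeneous_uminus: "homogeneous d f \<Longrightarrow> homogeneous d (- f)"
  by (auto simp: homogeneous_iff in_keys_iff)

lemma homogeneous_diff: "homogeneous d f \<Longrightarrow> homogeneous d g \<Longrightarrow> homogeneous d (f - g)"
  using homogeneous_add[of d f "- g"] homogeneous_uminus[of d g] by simp

lemma homogeneous_sum: "(\<And>i. i \<in> X \<Longrightarrow> homogeneous d (f i)) \<Longrightarrow> homogeneous d (sum f X)"
  by (induction X rule: infinite_finite_induct) (simp_all add: homogeneous_add)

lemma homogeneous_1: "homogeneous 0 1"
  by (simp add: homogeneous_iff)

lemma homogeneous_prod:
  "finite X \<Longrightarrow> (\<And>i. i \<in> X \<Longrightarrow> homogeneous 1 (f i)) \<Longrightarrow> homogeneous (card X) (prod f X)"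
proof (induction X rule: finite_induct)
  case (insert x X)
  then show ?case using homogeneous_mult[of 1 "f x" "card X" "prod f X"] by simp
qed (simp add: homogeneous_1)

lemma homogeneous_power: "homogeneous d f \<Longrightarrow> homogeneous (k * d) (f ^ k)"
proof (induction k)
  case (Suc k)
  then show ?case using homogeneous_mult[of d f "k * d" "f ^ k"] by simp
qed (simp add: homogeneous_1)

lemma homogeneous_mon:
  "(\<And>v. homogeneous 1 (x v)) \<Longrightarrow> homogeneous (mdeg m) (mon x m)"
proof (induction m rule: monomial_induct)
  case (add v n)
  then show ?case using homogeneous_mult[of 1 "x v" "mdeg n"] by simp
qed (simp add: homogeneous_1)

lemma homogeneous_subst:
  assumes "homogeneous d f" "\<And>v. homogeneous 1 (x v)"
  shows "homogeneous d (subst x f)"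
  unfolding subst_def
  using assms homogeneous_mon[of x]
  by (intro homogeneous_sum homogeneous_Const_mult) (auto simp: homogeneous_iff[of _ f])

text \<open>A form of degree \<open>d\<close> shifts the grading by \<open>d\<close>. With
  \<open>l\<close> nonzero this allows cancelling \<open>l\<close> one degree at a time.\<close>

lemma hcomp_mult_homogeneous:
  assumes "homogeneous d l"
  shows "hcomp r (l * h) = (if d \<le> r then l * hcomp (r - d) h else 0)"
proof (rule mpoly_induct_subset[of l])
  fix m assume "m \<in> keys l"
  then have m: "mdeg m = d" using assms by (simp add: homogeneous_iff)
  show "hcomp r (single m (lookup l m) * h) = (if d \<le> r then single m (lookup l m) * hcomp (r - d) h else 0)"
    by (induction h rule: mpoly_induct)
      (use m in \<open>auto simp: mult_single hcomp_single distrib_left\<close>)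
qed (simp_all add: distrib_right)

text \<open>Order of vanishing at the origin. Since \<open>shift P\<close> moves \<open>P\<close> to
  the origin, \<open>ord_ge m (shift P f)\<close> is the order at \<open>P\<close>, taken in affine
  space at a chosen representative of the projective point.\<close>

definition ord_ge :: "nat \<Rightarrow> ('v, 'k::comm_ring_1) mpoly \<Rightarrow> bool" where
  "ord_ge m f \<longleftrightarrow> (\<forall>n\<in>keys f. m \<le> mdeg n)"

definition shift :: "('v \<Rightarrow> 'k) \<Rightarrow> ('v, 'k::comm_ring_1) mpoly \<Rightarrow> ('v, 'k) mpoly" where
  "shift P f = subst (\<lambda>v. Var v + Const (P v)) f"

lemma ord_ge_iff_lookup: "ord_ge m f \<longleftrightarrow> (\<forall>n. mdeg n < m \<longrightarrow> lookup f n = 0)"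
  by (auto simp: ord_ge_def in_keys_iff not_less[symmetric])

lemma ord_ge_iff_hcomp: "ord_ge m f \<longleftrightarrow> (\<forall>r<m. hcomp r f = 0)"
  unfolding ord_ge_iff_lookup poly_mapping_eq_iff fun_eq_iff lookup_hcomp
  by (auto simp: when_def)

lemma ord_ge_0_right [simp]: "ord_ge m 0" by (simp add: ord_ge_def)
lemma ord_ge_0_left [simp]: "ord_ge 0 f" by (simp add: ord_ge_def)

lemma ord_ge_add: "ord_ge m f \<Longrightarrow> ord_ge m g \<Longrightarrow> ord_ge m (f + g)"
  by (simp add: ord_ge_iff_lookup lookup_add)

lemma ord_ge_sum: "(\<And>i. i \<in> X \<Longrightarrow> ord_ge m (f i)) \<Longrightarrow> ord_ge m (sum f X)"
  by (simp add: ord_ge_iff_lookup lookup_sum)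

lemma ord_ge_mult: "ord_ge m f \<Longrightarrow> ord_ge n g \<Longrightarrow> ord_ge (m + n) (f * g)"
  unfolding ord_ge_def 
proof safe
  fix k assume *: "\<forall>n\<in>keys f. m \<le> mdeg n" "\<forall>k\<in>keys g. n \<le> mdeg k" "k \<in> keys (f * g)"
  then obtain a b where "k = a + b" "a \<in> keys f" "b \<in> keys g" using keys_mult[of f g] by blast
  then show "m + n \<le> mdeg k" using * by (simp add: add_mono)
qed

lemma ord_ge_mult_left: "ord_ge n g \<Longrightarrow> ord_ge n (f * g)"
  using ord_ge_mult[of 0 f n g] by simp

lemma ord_ge_power: "ord_ge m f \<Longrightarrow> ord_ge (k * m) (f ^ k)"
  by (induction k) (simp_all add: ord_ge_mult)

lemma ord_ge_homogeneous: "homogeneous d f \<Longrightarrow> m \<le> d \<Longrightarrow> ord_ge m f"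
  by (simp add: homogeneous_iff ord_ge_def)

text \<open>A linear substitution sends a monomial to a form of the same degree, possibly zero, so
  no terms of lower degree arise.\<close>

lemma ord_ge_subst:
  assumes "ord_ge m f" "\<And>v. homogeneous 1 (x v)"
  shows "ord_ge m (subst x f)"
  unfolding subst_def
  using assms homogeneous_mon[of x]
  by (intro ord_ge_sum ord_ge_mult_left) (auto simp: ord_ge_def[of _ f] intro: ord_ge_homogeneous)

lemma shift_simps [simp]:
  "shift P (f + g) = shift P f + shift P g" "shift P (f * g) = shift P f * shift P g"
  "shift P (f - g) = shift P f - shift P g" "shift P (f ^ k) = shift P f ^ k"
  "shift P (Const c) = Const c" "shift P (Var v) = Var v + Const (P v)"
  "shift P (sum h X) = (\<Sum>i\<in>X. shift P (h i))" "shift P (prod h X) = (\<Prod>i\<in>X. shift P (h i))"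
  "shift P 1 = 1" "shift P 0 = 0"
  by (simp_all add: shift_def)

lemma mpoly_eval_zero [simp]: "mpoly_eval 0 a = 0"
  by (simp add: mpoly_eval_def)

lemma mpoly_eval_sum [simp]: "mpoly_eval (sum h X) a = (\<Sum>i\<in>X. mpoly_eval (h i) a)"
  by (induction X rule: infinite_finite_induct) simp_all

lemma mpoly_eval_0:
  fixes f :: "('v, 'k::comm_ring_1) mpoly"
  shows "mpoly_eval f (\<lambda>_. 0) = lookup f 0"
proof (induction f rule: mpoly_induct)
  case (single m c)
  show ?case
  proof (cases "m = 0")
    case False
    then obtain v where "v \<in> keys m" by (auto simp: in_keys_iff poly_mapping_eq_iff fun_eq_iff)
    then have "(\<Prod>v\<in>keys m. (0 :: 'k) ^ lookup m v) = 0"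
      by (intro prod_zero) (auto simp: in_keys_iff zero_power intro!: bexI[of _ v])
    then show ?thesis using False by (simp add: mpoly_eval_def lookup_single)
  qed (simp add: mpoly_eval_def)
qed (simp add: lookup_add)

lemma mpoly_eval_shift: "mpoly_eval (shift P f) (\<lambda>_. 0) = mpoly_eval f P"
proof -
  have "Const (mpoly_eval (shift P f) (\<lambda>_. 0)) = Const (mpoly_eval f P)"
    by (simp add: Const_mpoly_eval shift_def subst_subst)
  then show ?thesis by simp
qed

lemma mpoly_eval_eq_0_if_ord_ge: "ord_ge m (shift P f) \<Longrightarrow> m \<ge> 1 \<Longrightarrow> mpoly_eval f P = 0"
  by (simp add: ord_ge_iff_lookup mpoly_eval_0 flip: mpoly_eval_shift)

section \<open>The polynomial ring in the variables with index at most N\<close>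

lemma polyring_subring: "is_subring (polyring N)"
proof -
  have "f - g \<in> polyring N" if "f \<in> polyring N" "g \<in> polyring N" for f g :: "(nat, 'a) mpoly"
  proof -
    have "keys (f - g) \<subseteq> keys f \<union> keys g" by (auto simp: in_keys_iff lookup_minus)
    then show ?thesis using that unfolding polyring_def by blast
  qed
  moreover have "f * g \<in> polyring N" if "f \<in> polyring N" "g \<in> polyring N" for f g :: "(nat, 'a) mpoly"
    unfolding polyring_def
  proof safe
    fix k v assume k: "k \<in> keys (f * g)" and v: "v \<in> keys k"
    obtain a b where ab: "k = a + b" "a \<in> keys f" "b \<in> keys g" using k keys_mult[of f g] by blast
    then have "keys a \<subseteq> {..N}" "keys b \<subseteq> {..N}" using that unfolding polyring_def by blast+
    then show "v \<le> N" using v ab(1) by (auto simp: keys_add_nat)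
  qed
  moreover have "1 \<in> (polyring N :: (nat, 'a) mpoly set)" by (simp add: polyring_def)
  ultimately show ?thesis
    unfolding is_subring_def by blast
qed

lemma Const_in_polyring [simp]: "Const c \<in> polyring N"
  by (auto simp: polyring_def Const_def in_keys_iff lookup_single when_def split: if_splits)

lemma Var_in_polyring: "j \<le> N \<Longrightarrow> Var j \<in> polyring N"
  by (auto simp: polyring_def Var_def in_keys_iff lookup_single when_def split: if_splits)

lemma subst_in_polyring: "(\<And>v. x v \<in> polyring N) \<Longrightarrow> subst x f \<in> polyring N"
  unfolding subst_def
  by (intro subring_sum[OF polyring_subring] subring_mult[OF polyring_subring] Const_in_polyring
      subring_mon[OF polyring_subring])

lemma hcomp_in_polyring: "f \<in> polyring N \<Longrightarrow> hcomp r f \<in> polyring N"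
  by (auto simp: polyring_def in_keys_iff lookup_hcomp)

text \<open>A retraction onto \<open>polyring N\<close>. Divisibility is first obtained with
  infinitely many variables; applying \<open>restr\<close> brings the quotient back.\<close>

definition restr :: "nat \<Rightarrow> (nat, 'k::comm_ring_1) mpoly \<Rightarrow> (nat, 'k) mpoly" where
  "restr N f = subst (\<lambda>v. if v \<le> N then Var v else 0) f"

lemma restr_in_polyring: "restr N f \<in> polyring N"
  unfolding restr_def by (rule subst_in_polyring) (simp add: Var_in_polyring subring_0 polyring_subring)

lemma restr_id: "f \<in> polyring N \<Longrightarrow> restr N f = f"
  unfolding restr_def using subst_polyring_cong[of f N _ Var] by simp

text \<open>Modulo \<open>l\<close>, a substitution depends only on the residues of the images of
  the variables.\<close>

lemma dvd_subst_diff: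
  assumes "\<And>v. l dvd x v - y v"
  shows "l dvd subst x f - subst y f"
proof (induction f rule: mpoly_induct)
  case (single m c)
  have "l dvd mon x m - mon y m"
  proof (induction m rule: monomial_induct)
    case (add v n)
    have "mon x (single v 1 + n) - mon y (single v 1 + n)
      = (x v - y v) * mon x n + y v * (mon x n - mon y n)"
      by (simp add: algebra_simps)
    then show ?case using add assms[of v] by simp
  qed simp
  then show ?case
    by (simp add: subst_single dvd_mult flip: right_diff_distrib)
next
  case (add f g)
  then show ?case by (simp add: add_diff_add)
qed

subsection \<open>Star configurations\<close>

text \<open>A point with coordinates \<open>x\<^sub>0, \<dots>, x\<^sub>N\<close> is read as the polynomial \<open>\<Sum>j\<le>N. x\<^sub>j z\<^sup>j\<close>. Then \<open>lform N t\<close>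
  is evaluation at \<open>z = t\<close>, the substitution \<open>mult_root N t\<close> is multiplication by \<open>z - t\<close>, which
  parametrizes the zero set of \<open>lform N t\<close>, and \<open>star_pt S\<close> is the common zero of the
  hyperplanes \<open>lform N t\<close> for \<open>t \<in> S\<close>.\<close>

definition lform :: "nat \<Rightarrow> 'k \<Rightarrow> (nat, 'k::comm_ring_1) mpoly" where
  "lform N t = (\<Sum>j\<le>N. Const (t ^ j) * Var j)"

definition mult_root :: "nat \<Rightarrow> 'k \<Rightarrow> nat \<Rightarrow> (nat, 'k::comm_ring_1) mpoly" where
  "mult_root N t j = (if 0 < j \<and> j \<le> N then Var (j - 1) else 0) - (if j < N then Const t * Var j else 0)"

definition star_pt :: "'k::field set \<Rightarrow> nat \<Rightarrow> 'k" where
  "star_pt S j = coeff (\<Prod>s\<in>S. [:-s, 1:]) j"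

lemma homogeneous_lform: "homogeneous 1 (lform N t)"
  unfolding lform_def by (intro homogeneous_sum homogeneous_Const_mult homogeneous_Var)

lemma homogeneous_mult_root: "homogeneous 1 (mult_root N t j)"
  unfolding mult_root_def
  by (intro homogeneous_diff) (auto intro: homogeneous_Const_mult homogeneous_Var[unfolded One_nat_def])

lemma lform_in_polyring: "lform N t \<in> polyring N"
  unfolding lform_def
  by (intro subring_sum[OF polyring_subring] subring_mult[OF polyring_subring] Const_in_polyring
      Var_in_polyring) auto

lemma shift_lform: "shift P (lform N t) = lform N t + Const (\<Sum>j\<le>N. t ^ j * P j)"
  by (simp add: lform_def distrib_left sum.distrib Const_sum Const_mult)

lemma degree_star: "degree (\<Prod>s\<in>S. [:-s, 1::'k::field:]) = card S"
  by (subst degree_prod_eq_sum_degree) auto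

lemma lform_at_star: "card S = N \<Longrightarrow> (\<Sum>j\<le>N. t ^ j * star_pt S j) = (\<Prod>s\<in>S. t - s)"
  using poly_altdef[of "\<Prod>s\<in>S. [:-s, 1:]" t]
  by (simp add: degree_star star_pt_def poly_prod mult.commute)

text \<open>Adjoining \<open>t\<close> multiplies the polynomial that represents the point by z - t.
  The coefficients from index \<open>N\<close> on vanish for \<open>S\<close>, so this is exactly
  the formula of \<open>mult_root\<close>.\<close>

lemma star_pt_insert:
  assumes "finite S" "t \<notin> S" "card S + 1 = N"
  shows "star_pt (insert t S) j = (if 0 < j \<and> j \<le> N then star_pt S (j - 1) else 0) - (if j < N then t * star_pt S j else 0)"
proof -
  have "star_pt S i = 0" if "N \<le> i" for i
    unfolding star_pt_def using assms that by (intro coeff_eq_0) (simp add: degree_star)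
  moreover have "star_pt (insert t S) j = (if 0 < j then star_pt S (j - 1) else 0) - t * star_pt S j"
    using assms by (simp add: star_pt_def coeff_pCons split: nat.split)
  ultimately show ?thesis by auto
qed

text \<open>The parametrization of the hyperplane \<open>t\<close> is linear and takes
  \<open>star_pt S\<close> to \<open>star_pt (insert t S)\<close>. Hence an order of vanishing at a
  star point on the hyperplane passes to the restriction.\<close>

lemma shift_mult_root:
  assumes "finite S" "t \<notin> S" "card S + 1 = N"
  shows "subst (mult_root N t) (shift (star_pt (insert t S)) f) = shift (star_pt S) (subst (mult_root N t) f)"
proof -
  have "mult_root N t v + Const (star_pt (insert t S) v) = shift (star_pt S) (mult_root N t v)" for v
    unfolding star_pt_insert[OF assms] mult_root_def
    by (simp add: Const_diff Const_mult algebra_simps)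
  then show ?thesis
    unfolding shift_def subst_subst by simp
qed

lemma lform_dvd:
  assumes f: "f \<in> polyring N" and N: "N \<ge> 1" and z: "subst (mult_root N t) f = 0"
  shows "lform N t dvd f"
proof -
  \<comment> \<open>The coefficients of the quotient of the polynomial with coefficients
    \<open>Var j\<close> by z - t. The remainder is \<open>lform N t\<close>, so multiplying back by
    z - t recovers the variables modulo \<open>lform N t\<close>; hence \<open>f\<close> is
    congruent to a substitution into its restriction, which is zero.\<close>
  define y where "y i = (\<Sum>j=Suc i..N. Const (t ^ (j - Suc i)) * Var j)" for i
  have rec: "y i = Var (Suc i) + Const t * y (Suc i)" if "i < N" for i
  proof -
    have "y i = Var (Suc i) + (\<Sum>j=Suc (Suc i)..N. Const (t ^ (j - Suc i)) * Var j)"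
      unfolding y_def using that by (subst sum.atLeast_Suc_atMost) auto
    also have "(\<Sum>j=Suc (Suc i)..N. Const (t ^ (j - Suc i)) * Var j) = Const t * y (Suc i)"
      unfolding y_def sum_distrib_left
    proof (intro sum.cong refl)
      fix j assume "j \<in> {Suc (Suc i)..N}"
      then have "j - Suc i = Suc (j - Suc (Suc i))" by auto
      then show "Const (t ^ (j - Suc i)) * Var j = Const t * (Const (t ^ (j - Suc (Suc i))) * Var j)"
        by (simp only: power_Suc Const_mult mult.assoc)
    qed
    finally show ?thesis .
  qed
  have yN: "y N = 0" by (simp add: y_def)
  have "subst y (mult_root N t v) = Var v" if "0 < v" "v \<le> N" for v
    using that rec[of "v - 1"] yN by (auto simp: mult_root_def)
  moreover have "subst y (mult_root N t 0) = Var 0 - lform N t"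
  proof -
    have "lform N t = Var 0 + (\<Sum>j=Suc 0..N. Const (t ^ j) * Var j)"
      unfolding lform_def atMost_atLeast0 by (subst sum.atLeast_Suc_atMost) auto
    also have "(\<Sum>j=Suc 0..N. Const (t ^ j) * Var j) = Const t * y 0"
      unfolding y_def sum_distrib_left
    proof (intro sum.cong refl)
      fix j assume "j \<in> {Suc 0..N}"
      then have "j = Suc (j - Suc 0)" by auto
      then have "t ^ j = t * t ^ (j - Suc 0)" by (metis power_Suc)
      then show "Const (t ^ j) * Var j = Const t * (Const (t ^ (j - Suc 0)) * Var j)"
        by (simp only: Const_mult mult.assoc)
    qed
    finally show ?thesis using N by (simp add: mult_root_def)
  qed
  moreover have "subst y (mult_root N t v) = 0" if "v > N" for v
    using that by (simp add: mult_root_def)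
  ultimately have "lform N t dvd (if v \<le> N then Var v else 0) - subst y (mult_root N t v)" for v
    by (cases "v = 0"; cases "v \<le> N") auto
  then have "lform N t dvd restr N f - subst (\<lambda>v. subst y (mult_root N t v)) f"
    unfolding restr_def by (rule dvd_subst_diff)
  also have "subst (\<lambda>v. subst y (mult_root N t v)) f = 0"
    using z by (simp flip: subst_subst)
  finally show ?thesis using f by (simp add: restr_id)
qed

lemma subst_mult_root_lform_neq_0:
  fixes s t :: "'k::field"
  assumes "N \<ge> 1" "s \<noteq> t"
  shows "subst (mult_root N t) (lform N s) \<noteq> 0"
proof
  \<comment> \<open>\<open>P\<close> represents the constant polynomial 1, its image on the
    hyperplane represents z - t, and the value of the latter at \<open>s\<close> is
    \<open>s - t\<close>.\<close>
  define P where "P = (\<lambda>i::nat. if i = 0 then 1 else 0 :: 'k)"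
  have *: "mpoly_eval (subst (mult_root N t) g) P = mpoly_eval g (\<lambda>v. mpoly_eval (mult_root N t v) P)" for g
  proof -
    have "Const (mpoly_eval (subst (mult_root N t) g) P) = Const (mpoly_eval g (\<lambda>v. mpoly_eval (mult_root N t v) P))"
      by (simp add: Const_mpoly_eval subst_subst)
    then show ?thesis by simp
  qed
  have "mpoly_eval (mult_root N t v) P = (if v = 0 then - t else if v = 1 then 1 else 0)" for v
    using assms by (auto simp: mult_root_def P_def)
  then have "mpoly_eval (subst (mult_root N t) (lform N s)) P
      = (\<Sum>j\<le>N. s ^ j * (if j = 0 then - t else if j = 1 then 1 else 0))"
    by (simp add: * lform_def)
  also have "\<dots> = (\<Sum>j\<in>{0,1}. s ^ j * (if j = 0 then - t else if j = 1 then 1 else 0))"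
    using assms by (intro sum.mono_neutral_right) auto
  also have "\<dots> = s - t" by simp
  finally show "subst (mult_root N t) (lform N s) = 0 \<Longrightarrow> False"
    using assms by simp
qed

text \<open>The other forms restrict to nonzero forms on the hyperplane \<open>t\<close>, and the
  ring is a domain, so the cofactor restricts to zero as well and the factors split off one at a
  time.\<close>

lemma prod_lform_dvd:
  fixes f :: "(nat, 'k::field) mpoly"
  assumes "finite T" and f: "f \<in> polyring N" and N: "N \<ge> 1"
    and "\<And>t. t \<in> T \<Longrightarrow> subst (mult_root N t) f = 0"
  shows "\<exists>g\<in>polyring N. f = (\<Prod>t\<in>T. lform N t) * g"
  using assms(1,4)
proof (induction T)
  case empty
  then show ?case using f by auto
next
  case (insert t T)
  then obtain g where g: "g \<in> polyring N" and fg: "f = (\<Prod>t\<in>T. lform N t) * g" by auto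
  have "(\<Prod>s\<in>T. subst (mult_root N t) (lform N s)) * subst (mult_root N t) g = 0"
    using insert.prems[of t] by (simp add: fg)
  moreover have "subst (mult_root N t) (lform N s) \<noteq> 0" if "s \<in> T" for s
    using that insert.hyps(2) by (intro subst_mult_root_lform_neq_0[OF N]) auto
  then have "(\<Prod>s\<in>T. subst (mult_root N t) (lform N s)) \<noteq> 0"
    using insert.hyps(1) by (simp add: prod_zero_iff)
  ultimately have "subst (mult_root N t) g = 0" by simp
  then obtain h where h: "g = lform N t * h" using lform_dvd[OF g N, of t] by (auto simp: dvd_def)
  have "g = restr N g" using g by (simp add: restr_id)
  also have "\<dots> = restr N (lform N t) * restr N h" by (simp add: h restr_def)
  finally have "g = lform N t * restr N h" by (simp add: restr_id lform_in_polyring)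
  then show ?case using insert.hyps fg restr_in_polyring by (auto simp: algebra_simps)
qed

text \<open>For \<open>c = 0\<close> the factor is a linear form and costs one order. Otherwise the
  factor is nonzero at the origin: the lowest component of the product is \<open>c\<close> times
  that of \<open>h\<close>, so the components of \<open>h\<close> vanish one after another.\<close>

lemma ord_ge_affine_factor:
  fixes l h :: "('v::linorder, 'k::field) mpoly"
  assumes l: "homogeneous 1 l" "l \<noteq> 0" and ord: "ord_ge m ((l + Const c) * h)"
  shows "ord_ge (if c = 0 then m - 1 else m) h"
proof (cases "c = 0")
  case True
  have "hcomp r h = 0" if "r < m - 1" for r
  proof -
    have "hcomp (Suc r) (l * h) = 0"
      using ord that True by (simp add: ord_ge_iff_hcomp)
    then show ?thesis using l by (simp add: hcomp_mult_homogeneous)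
  qed
  then show ?thesis using True by (simp add: ord_ge_iff_hcomp)
next
  case False
  have "hcomp r h = 0" if "r < m" for r
    using that
  proof (induction r rule: less_induct)
    case (less r)
    have "hcomp r ((l + Const c) * h) = 0"
      using ord less.prems by (simp add: ord_ge_iff_hcomp)
    then have "Const c * hcomp r h = 0"
      using less by (simp add: distrib_right hcomp_mult_homogeneous[OF l(1)] hcomp_Const_mult split: if_splits)
    then show ?case using False by simp
  qed
  then show ?thesis using False by (simp add: ord_ge_iff_hcomp)
qed

lemma lform_neq_0: "lform N (t::'k::field) \<noteq> 0"
proof
  let ?P = "\<lambda>i::nat. if i = 0 then 1 else 0 :: 'k"
  assume "lform N t = 0"
  moreover have "mpoly_eval (lform N t) ?P = (\<Sum>j\<le>N. if j = 0 then 1 else 0)"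
    unfolding lform_def mpoly_eval_sum by (intro sum.cong) auto
  ultimately show False by simp
qed

lemma ord_ge_prod_lform:
  assumes "finite T" "ord_ge m ((\<Prod>t\<in>T. lform N t + Const (c t)) * h)"
  shows "ord_ge (m - card {t\<in>T. c t = (0::'k::field)}) h"
  using assms
proof (induction T arbitrary: m)
  case (insert t T)
  have "ord_ge (if c t = 0 then m - 1 else m) ((\<Prod>t\<in>T. lform N t + Const (c t)) * h)"
    using insert by (intro ord_ge_affine_factor[OF homogeneous_lform lform_neq_0]) (simp add: mult.assoc)
  from insert.IH[OF this] have *: "ord_ge ((if c t = 0 then m - 1 else m) - card {t\<in>T. c t = 0}) h" .
  have "{s \<in> insert t T. c s = 0} = (if c t = 0 then insert t {s\<in>T. c s = 0} else {s\<in>T. c s = 0})"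
    by auto
  then have "m - card {s \<in> insert t T. c s = 0} = (if c t = 0 then m - 1 else m) - card {t\<in>T. c t = 0}"
    using insert.hyps by auto
  then show ?case using * by simp
qed simp

text \<open>In dimension 0 there is a single point, with coordinate 1, and a form is a multiple of a
  power of \<open>Var 0\<close>, whose coefficient is its value there.\<close>

lemma star_base:
  fixes g :: "(nat, 'k::field) mpoly"
  assumes "g \<in> polyring 0" "homogeneous e g" "ord_ge m (shift (star_pt {}) g)" "m \<ge> 1"
  shows "g = 0"
proof -
  have "m = single 0 e" if "m \<in> keys g" for m
  proof -
    have "keys m \<subseteq> {0}" "mdeg m = e"
      using that assms by (auto simp: polyring_def homogeneous_iff)
    then have "lookup m v = lookup (single 0 e) v" for v
      using mdeg_superset[of "{0}" m] by (cases "v = 0") (auto simp: in_keys_iff lookup_single)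
    then show ?thesis by (rule poly_mapping_eqI)
  qed
  then have k: "lookup g n = 0" if "n \<noteq> single 0 e" for n
    using that by (auto simp: in_keys_iff)
  have "g = single (single 0 e) (lookup g (single 0 e))"
    by (rule poly_mapping_eqI) (auto simp: lookup_single when_def k)
  then obtain c where c: "g = single (single 0 e) c" by blast
  have "mpoly_eval g (star_pt {}) = 0"
    using assms by (intro mpoly_eval_eq_0_if_ord_ge)
  then have "c = 0" by (simp add: c mpoly_eval_def star_pt_def split: if_splits)
  then show ?thesis by (simp add: c)
qed

lemma mult_root_in_polyring: "N \<ge> 1 \<Longrightarrow> mult_root N t j \<in> polyring (N - 1)"
  unfolding mult_root_def
  by (intro subring_diff[OF polyring_subring])
    (auto intro!: subring_mult[OF polyring_subring] Var_in_polyring subring_0[OF polyring_subring])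

text \<open>All restrictions vanish, so the product of the \<open>card T\<close> forms divides
  \<open>f\<close>. Exactly \<open>N\<close> of them pass through each star point, so the cofactor
  has degree \<open>e - card T\<close> and order \<open>m - N\<close>; the inequality survives, and
  induction on \<open>e\<close> applies. Restriction is an assumption so that both cases of the
  induction on \<open>N\<close> can share this argument.\<close>

lemma star_configuration_step:
  fixes f :: "(nat, 'k::field) mpoly"
  assumes T: "finite T" "1 \<le> N" "N \<le> card T"
    and restrict: "\<And>f e m t. \<lbrakk>f \<in> polyring N; homogeneous e f;
      \<And>S. S \<subseteq> T \<Longrightarrow> card S = N \<Longrightarrow> ord_ge m (shift (star_pt S) f); N * e < m * card T; t \<in> T\<rbrakk>
      \<Longrightarrow> subst (mult_root N t) f = (0 :: (nat, 'k) mpoly)"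
    and f: "f \<in> polyring N" "homogeneous e f"
      "\<And>S. S \<subseteq> T \<Longrightarrow> card S = N \<Longrightarrow> ord_ge m (shift (star_pt S) f)" "N * e < m * card T"
  shows "f = 0"
  using f
proof (induction e arbitrary: f m rule: less_induct)
  case (less e)
  let ?L = "card T" and ?l = "\<Prod>t\<in>T. lform N t"
  obtain g where g: "g \<in> polyring N" "f = ?l * g"
    using prod_lform_dvd[OF T(1) less.prems(1) T(2)] restrict[OF less.prems] by blast
  have hl: "homogeneous ?L ?l" using T(1) homogeneous_lform by (rule homogeneous_prod)
  \<comment> \<open>As \<open>f\<close> is homogeneous, the cofactor may be replaced by one
    homogeneous component; if \<open>?L > e\<close>, then \<open>f = 0\<close> at once.\<close>
  have fe: "f = (if ?L \<le> e then ?l * hcomp (e - ?L) g else 0)"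
    using hcomp_homogeneous[OF less.prems(2), of e] hcomp_mult_homogeneous[OF hl, of e g] g(2) by simp
  show ?case
  proof (cases "?L \<le> e")
    case True
    define h where "h = hcomp (e - ?L) g"
    have fh: "f = ?l * h" using fe True by (simp add: h_def)
    have "h = 0"
    proof (rule less.IH)
      show "e - ?L < e" using True T by simp
      show "h \<in> polyring N" unfolding h_def using g(1) by (rule hcomp_in_polyring)
      show "homogeneous (e - ?L) h" unfolding h_def by (rule homogeneous_hcomp)
      \<comment> \<open>Both sides lose \<open>N * ?L\<close>, and \<open>?L \<le> e\<close> keeps
        the truncated subtraction on the left exact.\<close>
      show "N * (e - ?L) < (m - N) * ?L"
        unfolding diff_mult_distrib diff_mult_distrib2
        using less.prems(4) mult_le_mono2[OF True, of N] by (rule diff_less_mono)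
      fix S assume S: "S \<subseteq> T" "card S = N"
      then have fS: "finite S" using T finite_subset by blast
      have "shift (star_pt S) f = (\<Prod>t\<in>T. lform N t + Const (\<Prod>s\<in>S. t - s)) * shift (star_pt S) h"
        using S by (simp add: fh shift_lform lform_at_star)
      then have "ord_ge (m - card {t\<in>T. (\<Prod>s\<in>S. t - s) = 0}) (shift (star_pt S) h)"
        using less.prems(3)[OF S] T(1) by (intro ord_ge_prod_lform) simp_all
      moreover have "{t\<in>T. (\<Prod>s\<in>S. t - s) = 0} = S"
        using S fS by auto
      ultimately show "ord_ge (m - N) (shift (star_pt S) h)" using S by simp
    qed
    then show ?thesis by (simp add: fh)
  qed (simp add: fe)
qed

text \<open>Induction on the dimension: the star points on the hyperplane \<open>t\<close> form the
  configuration of \<open>T - {t}\<close> in one dimension less, so the restriction of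
  \<open>f\<close> vanishes by the induction hypothesis.\<close>

theorem star_configuration:
  fixes f :: "(nat, 'k::field) mpoly"
  assumes "1 \<le> N" "finite T" "N \<le> card T" "f \<in> polyring N" "homogeneous e f"
    and "\<And>S. S \<subseteq> T \<Longrightarrow> card S = N \<Longrightarrow> ord_ge m (shift (star_pt S) f)"
    and "N * e < m * card T"
  shows "f = 0"
  using assms
proof (induction N arbitrary: T f e m rule: nat_induct_at_least)
  case base
  show ?case
  proof (rule star_configuration_step[OF base(1) _ base(2) _ base(3-6)])
    fix f :: "(nat, 'k) mpoly" and e m t
    assume f: "f \<in> polyring 1" "homogeneous e f" "t \<in> T" "1 * e < m * card T"
      "\<And>S. S \<subseteq> T \<Longrightarrow> card S = 1 \<Longrightarrow> ord_ge m (shift (star_pt S) f)"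
    have "ord_ge m (subst (mult_root 1 t) (shift (star_pt {t}) f))"
      using f by (intro ord_ge_subst homogeneous_mult_root) auto
    then have "ord_ge m (shift (star_pt {}) (subst (mult_root 1 t) f))"
      using shift_mult_root[of "{}" t 1 f] by simp
    moreover have "m \<ge> 1" using f(4) by (cases m) auto
    moreover have "subst (mult_root 1 t) f \<in> polyring 0"
      using mult_root_in_polyring[of 1 t] by (intro subst_in_polyring) simp
    ultimately show "subst (mult_root 1 t) f = 0"
      using f by (intro star_base[of _ e m] homogeneous_subst homogeneous_mult_root)
  qed simp_all
next
  case (Suc N)
  show ?case
  proof (rule star_configuration_step[OF Suc(3) _ Suc(4) _ Suc(5-8)])
    fix f :: "(nat, 'k) mpoly" and e m t
    assume f: "f \<in> polyring (Suc N)" "homogeneous e f" "t \<in> T" "Suc N * e < m * card T"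
      "\<And>S. S \<subseteq> T \<Longrightarrow> card S = Suc N \<Longrightarrow> ord_ge m (shift (star_pt S) f)"
    have cT: "card (T - {t}) = card T - 1" using f(3) Suc(3) by simp
    show "subst (mult_root (Suc N) t) f = 0"
    proof (rule Suc.IH[of "T - {t}" _ e m])
      show "subst (mult_root (Suc N) t) f \<in> polyring N"
        using mult_root_in_polyring[of "Suc N" t] by (intro subst_in_polyring) simp
      show "homogeneous e (subst (mult_root (Suc N) t) f)"
        using f by (intro homogeneous_subst homogeneous_mult_root)
      show "N \<le> card (T - {t})" using Suc(4) cT by simp
      show "N * e < m * card (T - {t})"
      proof -
        \<comment> \<open>Dropping a hyperplane decreases the right side. After multiplication by
          \<open>Suc N\<close>, the surplus \<open>m * N\<close> is absorbed because
          \<open>N \<le> L\<close>.\<close>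
        obtain L where L: "card T = Suc L" "N \<le> L" using Suc(4) by (cases "card T") auto
        have "Suc N * (N * e) < Suc N * (m * L)"
        proof -
          have "Suc N * (N * e) < N * (m * card T)"
            using mult_less_mono2[OF f(4), of N] Suc(1) by (simp only: mult.left_commute)
          also have "\<dots> = m * (N * L + N)" by (simp add: L algebra_simps)
          also have "\<dots> \<le> m * (N * L + L)" using L(2) by simp
          also have "\<dots> = Suc N * (m * L)" by (simp add: algebra_simps)
          finally show ?thesis .
        qed
        then have "N * e < m * L" by (simp only: mult_less_cancel1)
        then show ?thesis using L cT by simp
      qed
      fix S assume S: "S \<subseteq> T - {t}" "card S = N"
      then have fS: "finite S" "t \<notin> S" using Suc(3) finite_subset[of S T] by auto
      then have "ord_ge m (shift (star_pt (insert t S)) f)"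
        using f S by (intro f(5)) auto
      then have "ord_ge m (subst (mult_root (Suc N) t) (shift (star_pt (insert t S)) f))"
        by (intro ord_ge_subst homogeneous_mult_root)
      then show "ord_ge m (shift (star_pt S) (subst (mult_root (Suc N) t) f))"
        using shift_mult_root[OF fS, of "Suc N" f] S by simp
    qed (use Suc(3) in auto)
  qed simp_all
qed

subsection \<open>Primes that become units in finitely generated rings\<close>

definition zring :: "'r::comm_ring_1 set \<Rightarrow> 'r set" where
  "zring S = \<Inter>{A. is_subring A \<and> S \<subseteq> A}"

lemma zring_subring: "is_subring (zring S)"
  by (auto simp: zring_def is_subring_def)

lemma zring_superset: "S \<subseteq> zring S"
  by (auto simp: zring_def)

lemma zring_minimal: "is_subring A \<Longrightarrow> S \<subseteq> A \<Longrightarrow> zring S \<subseteq> A"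
  by (auto simp: zring_def)

definition coeffs_sub :: "'r::comm_ring_1 set \<Rightarrow> 'r poly set" where
  "coeffs_sub A = {q. \<forall>i. coeff q i \<in> A}"

lemma coeffs_sub_subring:
  assumes A: "is_subring A"
  shows "is_subring (coeffs_sub A)"
  using A subring_0[OF A] subring_1[OF A]
  by (auto simp: is_subring_def coeffs_sub_def coeff_mult intro!: subring_sum[OF A])

lemma zring_insert: "zring (insert b S) \<subseteq> (\<lambda>q. poly q b) ` coeffs_sub (zring S)"
proof (rule zring_minimal)
  let ?C = "coeffs_sub (zring S)"
  have C: "is_subring ?C" by (intro coeffs_sub_subring zring_subring)
  show "is_subring ((\<lambda>q. poly q b) ` ?C)"
    unfolding is_subring_def
  proof (intro conjI ballI)
    show "1 \<in> (\<lambda>q. poly q b) ` ?C"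
      using subring_1[OF C] by (intro image_eqI[of _ _ 1]) auto
    fix x y assume "x \<in> (\<lambda>q. poly q b) ` ?C" "y \<in> (\<lambda>q. poly q b) ` ?C"
    then obtain q r where qr: "q \<in> ?C" "r \<in> ?C" "x = poly q b" "y = poly r b" by blast
    show "x - y \<in> (\<lambda>q. poly q b) ` ?C"
      using qr by (intro image_eqI[of _ _ "q - r"] subring_diff[OF C]) auto
    show "x * y \<in> (\<lambda>q. poly q b) ` ?C"
      using qr by (intro image_eqI[of _ _ "q * r"] subring_mult[OF C]) auto
  qed
  note R = subring_0[OF zring_subring, of S] subring_1[OF zring_subring, of S]
  have "[:0, 1:] \<in> ?C" using R by (auto simp: coeffs_sub_def coeff_pCons split: nat.split)
  then have "b \<in> (\<lambda>q. poly q b) ` ?C" by (intro image_eqI[of _ _ "[:0, 1:]"]) auto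
  moreover have "c \<in> (\<lambda>q. poly q b) ` ?C" if "c \<in> S" for c
    using that zring_superset[of S] R
    by (intro image_eqI[of _ _ "[:c:]"]) (auto simp: coeffs_sub_def coeff_pCons split: nat.split)
  ultimately show "insert b S \<subseteq> (\<lambda>q. poly q b) ` ?C" by blast
qed

text \<open>The primes collected for \<open>c\<close> are those that become units in the localization \<open>A[1/c]\<close>.\<close>

definition few_unit_primes :: "'r::comm_ring_1 set \<Rightarrow> bool" where
  "few_unit_primes A \<longleftrightarrow>
     (\<forall>c\<in>A. c \<noteq> 0 \<longrightarrow> finite {p::nat. prime p \<and> (\<exists>M. \<exists>g\<in>A. c ^ M = of_nat p * g)})"

lemma few_unit_primes_mono: "few_unit_primes B \<Longrightarrow> A \<subseteq> B \<Longrightarrow> few_unit_primes A"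
  unfolding few_unit_primes_def
proof (intro ballI impI)
  fix c assume "\<forall>c\<in>B. c \<noteq> 0 \<longrightarrow> finite {p. prime p \<and> (\<exists>M. \<exists>g\<in>B. c ^ M = of_nat p * g)}"
    and "A \<subseteq> B" "c \<in> A" "c \<noteq> 0"
  then have "finite {p. prime p \<and> (\<exists>M. \<exists>g\<in>B. c ^ M = of_nat p * g)}" by blast
  then show "finite {p. prime p \<and> (\<exists>M. \<exists>g\<in>A. c ^ M = of_nat p * g)}"
    by (rule rev_finite_subset) (use \<open>A \<subseteq> B\<close> in blast)
qed

text \<open>A prime dividing a power of \<open>n\<close> divides \<open>n\<close>, and a nonzero
  integer has finitely many divisors.\<close>

lemma few_unit_primes_int: "few_unit_primes (range (of_int :: int \<Rightarrow> 'r::{idom,ring_char_0}))"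
  unfolding few_unit_primes_def
proof safe
  fix n :: int assume n: "of_int n \<noteq> (0::'r)"
  have "int p dvd n" if "prime p" "of_int n ^ M = of_nat p * (of_int g :: 'r)" for p M g
  proof -
    have "of_int (n ^ M) = (of_int (int p * g) :: 'r)" using that by simp
    then have "n ^ M = int p * g" by (simp only: of_int_eq_iff)
    then have "int p dvd n ^ M" by simp
    then show ?thesis using that(1) prime_dvd_power[of "int p" n M] by simp
  qed
  then have "{p. prime p \<and> (\<exists>M. \<exists>g\<in>range of_int. of_int n ^ M = (of_nat p * g :: 'r))} \<subseteq> nat ` {d. d dvd n}"
    by (intro subsetI image_eqI[of _ nat "int _"]) auto
  then show "finite {p. prime p \<and> (\<exists>M. \<exists>g\<in>range of_int. of_int n ^ M = (of_nat p * g :: 'r))}"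
    by (rule finite_subset) (use n in simp)
qed

text \<open>The leading coefficient of \<open>h\<close> need not be invertible in \<open>A\<close>,
  so each cancellation of a top term is paid for with a factor \<open>lead_coeff h\<close>.\<close>

lemma pseudo_division_in:
  fixes h q :: "'r::idom poly"
  assumes A: "is_subring A" and h: "h \<in> coeffs_sub A" "h \<noteq> 0" and q: "q \<in> coeffs_sub A"
  shows "\<exists>k. \<exists>w\<in>coeffs_sub A. \<exists>r\<in>coeffs_sub A.
    smult (lead_coeff h ^ k) q = h * w + r \<and> (r = 0 \<or> degree r < degree h)"
  using q
proof (induction "degree q" arbitrary: q rule: less_induct)
  case less
  let ?l = "lead_coeff h"
  note C = coeffs_sub_subring[OF A]
  have sm: "smult a v \<in> coeffs_sub A" if "a \<in> A" "v \<in> coeffs_sub A" for a v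
    using that subring_mult[OF A] by (auto simp: coeffs_sub_def)
  have lA: "?l ^ k \<in> A" for k using h(1) by (intro subring_power[OF A]) (simp add: coeffs_sub_def)
  show ?case
  proof (cases "q = 0 \<or> degree q < degree h")
    case True
    then show ?thesis
      using less.prems subring_0[OF C] by (intro exI[of _ 0] bexI[of _ 0] bexI[of _ q]) auto
  next
    case False
    define u where "u = monom (lead_coeff q) (degree q - degree h)"
    have u: "u \<in> coeffs_sub A"
      using less.prems subring_0[OF A] by (auto simp: u_def coeffs_sub_def)
    define q' where "q' = smult ?l q - h * u"
    have q': "q' \<in> coeffs_sub A"
      unfolding q'_def using lA[of 1] less.prems u h(1)
      by (intro subring_diff[OF C] subring_mult[OF C] sm) auto
    have dhu: "degree (h * u) = degree q" and lhu: "coeff (h * u) (degree q) = ?l * lead_coeff q"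
      using False h(2) lead_coeff_mult[of h u]
      by (auto simp: u_def degree_mult_eq degree_monom_eq monom_eq_0_iff)
    have "degree q' \<le> degree q"
      unfolding q'_def using dhu by (intro degree_diff_le) auto
    moreover have "coeff q' (degree q) = 0" unfolding q'_def using lhu by simp
    ultimately have dq': "q' = 0 \<or> degree q' < degree q"
      using leading_coeff_0_iff[of q'] by (cases "degree q' = degree q") auto
    have "\<exists>k. \<exists>w\<in>coeffs_sub A. \<exists>r\<in>coeffs_sub A.
      smult (?l ^ k) q' = h * w + r \<and> (r = 0 \<or> degree r < degree h)"
    proof (cases "q' = 0")
      case True
      then show ?thesis
        using subring_0[OF C] by (intro exI[of _ 0] bexI[of _ 0]) auto
    qed (use dq' less.hyps q' in blast)
    then obtain k w r where wr: "w \<in> coeffs_sub A" "r \<in> coeffs_sub A"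
      "smult (?l ^ k) q' = h * w + r" "r = 0 \<or> degree r < degree h" by blast
    have "smult (?l ^ Suc k) q = smult (?l ^ k) (q' + h * u)"
      by (simp add: q'_def mult.commute)
    also have "\<dots> = h * (w + smult (?l ^ k) u) + r"
      using wr(3) by (simp add: smult_add_right algebra_simps)
    finally show ?thesis
      using wr subring_add[OF C wr(1) sm[OF lA u, of k]] by blast
  qed
qed

text \<open>For each nonzero element of A[b] there is a nonzero element of \<open>A\<close> with at
  least as many bad primes. If \<open>b\<close> is transcendental over \<open>A\<close>, a leading
  coefficient serves. If \<open>b\<close> is algebraic, the element divides some nonzero
  \<open>a\<close> in \<open>A\<close>, and reduction modulo a relation of least degree moves
  divisibility by \<open>p\<close> into \<open>A\<close>, at the cost of powers of a leading
  coefficient.\<close>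

lemma few_unit_primes_adjoin:
  fixes A :: "'r::{idom,ring_char_0} set"
  assumes A: "is_subring A" and few: "few_unit_primes A"
  shows "few_unit_primes ((\<lambda>q. poly q b) ` coeffs_sub A)"
proof -
  let ?C = "coeffs_sub A"
  note C = coeffs_sub_subring[OF A]
  have cA: "coeff q i \<in> A" if "q \<in> ?C" for q i using that by (simp add: coeffs_sub_def)
  have sm: "smult a v \<in> ?C" if "a \<in> A" "v \<in> ?C" for a v
    using that subring_mult[OF A] by (auto simp: coeffs_sub_def)
  have const: "[:a:] \<in> ?C" if "a \<in> A" for a
    using that subring_0[OF A] by (auto simp: coeffs_sub_def coeff_pCons split: nat.split)
  let ?bad = "\<lambda>R c. {p::nat. prime p \<and> (\<exists>M. \<exists>g\<in>R. c ^ M = of_nat p * g)}"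
  let ?B = "(\<lambda>q. poly q b) ` ?C"
  have "\<exists>c\<in>A. c \<noteq> 0 \<and> ?bad ?B (poly q b) \<subseteq> ?bad A c" if q: "q \<in> ?C" "poly q b \<noteq> 0" for q
  proof (cases "\<forall>h\<in>?C. poly h b = 0 \<longrightarrow> h = 0")
    case True
    have "lead_coeff q ^ M = of_nat p * coeff g (M * degree q)"
      if g: "g \<in> ?C" "poly q b ^ M = of_nat p * poly g b" for p M g
    proof -
      have "poly (q ^ M - smult (of_nat p) g) b = 0" using g by simp
      moreover have "q ^ M - smult (of_nat p) g \<in> ?C"
        using q g A by (intro subring_diff[OF C] subring_power[OF C] sm subring_of_nat)
      ultimately have "q ^ M = smult (of_nat p) g" using True by auto
      then have "coeff (q ^ M) (M * degree q) = of_nat p * coeff g (M * degree q)" by simp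
      then show ?thesis using lead_coeff_power[of q M] q by (cases "q = 0") (simp_all add: degree_power_eq)
    qed
    then have "?bad ?B (poly q b) \<subseteq> ?bad A (lead_coeff q)"
      using cA by blast
    moreover have "lead_coeff q \<noteq> 0" using q by auto
    ultimately show ?thesis using cA[OF q(1)] by blast
  next
    case False
    then have ex: "\<exists>d h. h \<in> ?C \<and> poly h b = 0 \<and> h \<noteq> 0 \<and> degree h = d" by auto
    \<comment> \<open>The least degree of a nonzero relation for \<open>b\<close> with coefficients
      in \<open>A\<close>. It stands in for the degree of the minimal polynomial: polynomials over
      \<open>A\<close> of smaller degree are determined by their values at \<open>b\<close>.\<close>
    define d where "d = (LEAST d. \<exists>h. h \<in> ?C \<and> poly h b = 0 \<and> h \<noteq> 0 \<and> degree h = d)"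
    obtain h where h: "h \<in> ?C" "poly h b = 0" "h \<noteq> 0" "degree h = d"
      using LeastI_ex[OF ex] unfolding d_def by blast
    have min: "v = 0" if "v \<in> ?C" "poly v b = 0" "v = 0 \<or> degree v < d" for v
      using that not_less_Least[of "degree v", folded d_def] d_def by blast
    have d0: "d > 0"
    proof (rule ccontr)
      assume "\<not> d > 0"
      then obtain a where "h = [:a:]" using h(4) by (auto elim: degree_eq_zeroE)
      then show False using h by simp
    qed
    let ?l = "lead_coeff h"
    have lA: "?l ^ k \<in> A" for k using cA[OF h(1)] by (intro subring_power[OF A])
    \<comment> \<open>A Euclidean descent. Below degree \<open>d\<close>, divide \<open>h\<close> by
      \<open>v\<close>: a remainder vanishing at \<open>b\<close> would make the quotient a relation
      of smaller degree. From degree \<open>d\<close> on, divide \<open>v\<close> by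
      \<open>h\<close>.\<close>
    have "\<exists>u\<in>?C. \<exists>a\<in>A. poly v b * poly u b = a \<and> a \<noteq> 0" if "v \<in> ?C" "poly v b \<noteq> 0" for v
      using that
    proof (induction "degree v" arbitrary: v rule: less_induct)
      case less
      consider "degree v = 0" | "0 < degree v" "degree v < d" | "d \<le> degree v" by linarith
      then show ?case
      proof cases
        case 1
        then obtain a where "v = [:a:]" by (auto elim: degree_eq_zeroE)
        then have "a \<in> A" "poly v b * poly 1 b = a" "a \<noteq> 0"
          using less.prems cA[OF less.prems(1), of 0] by auto
        then show ?thesis using subring_1[OF C] by blast
      next
        case 2
        have v0: "v \<noteq> 0" using 2 by auto
        obtain k w r where wr: "w \<in> ?C" "r \<in> ?C" "smult (lead_coeff v ^ k) h = v * w + r"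
          "r = 0 \<or> degree r < degree v"
          using pseudo_division_in[OF A less.prems(1) v0 h(1)] by blast
        have e: "poly v b * poly w b + poly r b = 0"
          using arg_cong[OF wr(3), of "\<lambda>f. poly f b"] h(2) by simp
        have "poly r b \<noteq> 0"
        proof
          assume r0: "poly r b = 0"
          then have "r = 0" using min[of r] wr 2 by auto
          then have vw: "smult (lead_coeff v ^ k) h = v * w" using wr by simp
          then have w0: "w \<noteq> 0" using h v0 by auto
          have "degree h = degree v + degree w"
            using arg_cong[OF vw, of degree] v0 w0 by (simp add: degree_mult_eq)
          moreover have "poly w b = 0" using e r0 less.prems by simp
          ultimately show False using min[of w] w0 wr 2 h by auto
        qed
        moreover then have "degree r < degree v" using wr by auto
        ultimately obtain u a where u: "u \<in> ?C" "a \<in> A" "poly r b * poly u b = a" "a \<noteq> 0"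
          using less.hyps wr(2) by blast
        have "poly v b * poly (- (w * u)) b = (poly v b * poly w b) * (- poly u b)" by simp
        also have "poly v b * poly w b = - poly r b" using e by (simp add: eq_neg_iff_add_eq_0)
        also have "- poly r b * - poly u b = a" using u by simp
        finally show ?thesis using u subring_uminus[OF C subring_mult[OF C wr(1) u(1)]] by blast
      next
        case 3
        obtain k w r where wr: "w \<in> ?C" "r \<in> ?C" "smult (?l ^ k) v = h * w + r"
          "r = 0 \<or> degree r < degree h"
          using pseudo_division_in[OF A h(1,3) less.prems(1)] by blast
        have e: "?l ^ k * poly v b = poly r b"
          using arg_cong[OF wr(3), of "\<lambda>f. poly f b"] h(2) by simp
        have "?l ^ k * poly v b \<noteq> 0" using less.prems h(3) by simp
        then have r0: "poly r b \<noteq> 0" using e by simp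
        then have "degree r < degree v" using wr 3 h by auto
        then obtain u a where u: "u \<in> ?C" "a \<in> A" "poly r b * poly u b = a" "a \<noteq> 0"
          using less.hyps wr(2) r0 by blast
        have "poly v b * poly (smult (?l ^ k) u) b = a" using e u by (simp add: algebra_simps)
        then show ?thesis using u sm[OF lA u(1), of k] by blast
      qed
    qed
    then obtain u a where u: "u \<in> ?C" "a \<in> A" "poly q b * poly u b = a" "a \<noteq> 0"
      using q by blast
    have "\<exists>M'. \<exists>g'\<in>A. (?l * a) ^ M' = of_nat p * g'"
      if g: "g \<in> ?C" "poly q b ^ M = of_nat p * poly g b" for p :: nat and M g
    proof -
      have gu: "g * u ^ M \<in> ?C" using g u by (intro subring_mult[OF C] subring_power[OF C])
      obtain k w r where wr: "w \<in> ?C" "r \<in> ?C" "smult (?l ^ k) (g * u ^ M) = h * w + r"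
        "r = 0 \<or> degree r < degree h"
        using pseudo_division_in[OF A h(1,3) gu] by blast
      have "a ^ M = of_nat p * poly (g * u ^ M) b"
        using g(2) by (simp add: u(3)[symmetric] power_mult_distrib)
      moreover have "?l ^ k * poly (g * u ^ M) b = poly r b"
        using arg_cong[OF wr(3), of "\<lambda>f. poly f b"] h(2) by simp
      ultimately have "?l ^ k * a ^ M = of_nat p * poly r b" by (simp add: mult.left_commute)
      \<comment> \<open>This polynomial has degree below \<open>d\<close> and vanishes at
        \<open>b\<close>, hence is zero; its constant coefficient gives an identity inside
        \<open>A\<close>.\<close>
      then have "poly ([:?l ^ k * a ^ M:] - smult (of_nat p) r) b = 0" by simp
      moreover have "[:?l ^ k * a ^ M:] - smult (of_nat p) r \<in> ?C"
        using wr u by (intro subring_diff[OF C] const sm subring_mult[OF A] lA subring_power[OF A] subring_of_nat[OF A])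
      moreover have "degree ([:?l ^ k * a ^ M:] - smult (of_nat p) r) < d"
        using wr(4) h(4) d0 by (intro degree_diff_less) auto
      ultimately have "[:?l ^ k * a ^ M:] - smult (of_nat p) r = 0" using min by blast
      then have "coeff ([:?l ^ k * a ^ M:] - smult (of_nat p) r) 0 = 0" by simp
      then have "?l ^ k * a ^ M = of_nat p * coeff r 0" by simp
      \<comment> \<open>The exponents \<open>k\<close> and \<open>M\<close> may differ; multiplying
        by \<open>?l ^ M * a ^ k\<close> produces a power of one element that depends neither on
        \<open>p\<close> nor on \<open>g\<close>.\<close>
      then have "(?l * a) ^ (k + M) = of_nat p * (coeff r 0 * (?l ^ M * a ^ k))"
        by (simp add: power_add power_mult_distrib algebra_simps)
      moreover have "coeff r 0 * (?l ^ M * a ^ k) \<in> A"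
        using cA[OF wr(2)] u by (intro subring_mult[OF A] lA subring_power[OF A])
      ultimately show ?thesis by blast
    qed
    then have "?bad ?B (poly q b) \<subseteq> ?bad A (?l * a)" by blast
    moreover have "?l * a \<in> A" "?l * a \<noteq> 0"
      using u h lA[of 1] by (auto intro: subring_mult[OF A])
    ultimately show ?thesis by blast
  qed
  then have "finite (?bad ?B (poly q b))" if "q \<in> ?C" "poly q b \<noteq> 0" for q
    using that few finite_subset unfolding few_unit_primes_def by meson
  then show ?thesis
    unfolding few_unit_primes_def by blast
qed

theorem few_unit_primes_zring:
  fixes S :: "'r::{idom,ring_char_0} set"
  assumes "finite S"
  shows "few_unit_primes (zring S)"
  using assms
proof induction
  case empty
  have "is_subring (\<int> :: 'r set)" by (auto simp: is_subring_def)
  then have "zring {} \<subseteq> (\<int> :: 'r set)" by (intro zring_minimal) auto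
  then show ?case unfolding Ints_def by (rule few_unit_primes_mono[OF few_unit_primes_int])
next
  case (insert b S)
  show ?case
    by (rule few_unit_primes_mono[OF few_unit_primes_adjoin[OF zring_subring insert.IH] zring_insert])
qed

subsection \<open>Integer polynomial functions of the points\<close>

text \<open>Integer coefficients ensure that values lie in every subring containing the coordinates
  and that the functions commute with \<open>p\<close>-th powers modulo \<open>p\<close>.\<close>

inductive_set ipf :: "nat \<Rightarrow> nat \<Rightarrow> ((nat \<times> nat \<Rightarrow> 'k::comm_ring_1) \<Rightarrow> 'k) set" for s N where
  one: "(\<lambda>_. 1) \<in> ipf s N"
| var: "i < s \<Longrightarrow> j \<le> N \<Longrightarrow> (\<lambda>a. a (i, j)) \<in> ipf s N"
| diff: "f \<in> ipf s N \<Longrightarrow> g \<in> ipf s N \<Longrightarrow> (\<lambda>a. f a - g a) \<in> ipf s N"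
| mult: "f \<in> ipf s N \<Longrightarrow> g \<in> ipf s N \<Longrightarrow> (\<lambda>a. f a * g a) \<in> ipf s N"

lemma ipf_zero: "(\<lambda>_. 0) \<in> ipf s N"
  using ipf.diff[OF ipf.one ipf.one] by simp

lemma ipf_add:
  assumes "f \<in> ipf s N" "g \<in> ipf s N"
  shows "(\<lambda>a. f a + g a) \<in> ipf s N"
  using ipf.diff[OF assms(1) ipf.diff[OF ipf_zero assms(2)]] by simp

lemma ipf_prod: "(\<And>i. i \<in> X \<Longrightarrow> f i \<in> ipf s N) \<Longrightarrow> (\<lambda>a. \<Prod>i\<in>X. f i a) \<in> ipf s N"
  by (induction X rule: infinite_finite_induct) (simp_all add: ipf.one ipf.mult)

lemma ipf_mpoly_eval:
  assumes "f \<in> ipf s N"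
  shows "\<exists>P. (\<forall>m\<in>keys P. keys m \<subseteq> {..<s} \<times> {..N}) \<and> (\<forall>a. mpoly_eval P a = f a)"
  using assms
proof induction
  case one
  have "mpoly_eval 1 a = 1" for a :: "nat \<times> nat \<Rightarrow> 'a" using mpoly_eval_Const[of 1 a] by simp
  then show ?case by (intro exI[of _ 1]) simp
next
  case (var i j)
  show ?case
  proof (intro exI conjI)
    show "\<forall>m\<in>keys (Var (i, j) :: (nat \<times> nat, 'a) mpoly). keys m \<subseteq> {..<s} \<times> {..N}"
      using var by (simp add: Var_def)
  qed simp
next
  case (diff f g)
  then obtain P Q where PQ: "\<forall>m\<in>keys P. keys m \<subseteq> {..<s} \<times> {..N}" "\<forall>a. mpoly_eval P a = f a"
     "\<forall>m\<in>keys Q. keys m \<subseteq> {..<s} \<times> {..N}" "\<forall>a. mpoly_eval Q a = g a" by blast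
  have "keys (P - Q) \<subseteq> keys P \<union> keys Q" by (auto simp: in_keys_iff lookup_minus)
  then have "\<forall>m\<in>keys (P - Q). keys m \<subseteq> {..<s} \<times> {..N}" using PQ by blast
  then show ?case using PQ by (intro exI[of _ "P - Q"]) simp
next
  case (mult f g)
  then obtain P Q where PQ: "\<forall>m\<in>keys P. keys m \<subseteq> {..<s} \<times> {..N}" "\<forall>a. mpoly_eval P a = f a"
     "\<forall>m\<in>keys Q. keys m \<subseteq> {..<s} \<times> {..N}" "\<forall>a. mpoly_eval Q a = g a" by blast
  have "keys m \<subseteq> {..<s} \<times> {..N}" if m: "m \<in> keys (P * Q)" for m
  proof -
    obtain u v where uv: "m = u + v" "u \<in> keys P" "v \<in> keys Q" using m keys_mult[of P Q] by blast
    then have "keys u \<subseteq> {..<s} \<times> {..N}" "keys v \<subseteq> {..<s} \<times> {..N}" using PQ(1,3) by blast+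
    then show ?thesis unfolding uv(1) keys_add_nat by (rule Un_least)
  qed
  then show ?case using PQ by (intro exI[of _ "P * Q"]) simp
qed

lemma ipf_in_subring:
  assumes "f \<in> ipf s N" "is_subring A" "\<And>i j. i < s \<Longrightarrow> j \<le> N \<Longrightarrow> a (i, j) \<in> A"
  shows "f a \<in> A"
  using assms(1)
  by induction (auto intro: assms subring_1 subring_diff subring_mult)

text \<open>The inner binomial coefficients are divisible by \<open>p\<close>, and
  \<open>odd p\<close> gives the sign of the last term. The factor \<open>c\<close> is found inside
  \<open>A\<close>, which is what a congruence modulo \<open>p\<close> means there.\<close>

lemma freshman_diff:
  assumes A: "is_subring A" and xy: "x \<in> A" "y \<in> A" and p: "prime p" "odd p"
  shows "\<exists>c\<in>A. (x - y) ^ p = x ^ p - y ^ p + of_nat p * c"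
proof -
  have p2: "p > 0" using p by (simp add: prime_gt_0_nat)
  have ex: "\<exists>c. p choose k = p * c" if "k \<in> {0<..<p}" for k
  proof -
    have "p dvd p choose k" using that p(1) by (intro dvd_choose_prime) auto
    then show ?thesis by (auto simp: dvd_def)
  qed
  then obtain c where c: "p choose k = p * c k" if "k \<in> {0<..<p}" for k by metis
  have "(x + - y) ^ p = (\<Sum>k\<le>p. of_nat (p choose k) * x ^ k * (- y) ^ (p - k))"
    by (rule binomial_ring)
  also have "{..p} = insert 0 (insert p {0<..<p})" using p2 by auto
  also have "(\<Sum>k\<in>\<dots>. of_nat (p choose k) * x ^ k * (- y) ^ (p - k))
    = (- y) ^ p + (x ^ p + (\<Sum>k\<in>{0<..<p}. of_nat (p choose k) * x ^ k * (- y) ^ (p - k)))"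
    using p2 by simp
  also have "(\<Sum>k\<in>{0<..<p}. of_nat (p choose k) * x ^ k * (- y) ^ (p - k))
    = of_nat p * (\<Sum>k\<in>{0<..<p}. of_nat (c k) * x ^ k * (- y) ^ (p - k))"
    unfolding sum_distrib_left by (intro sum.cong refl) (simp add: c mult.assoc)
  also have "(- y) ^ p = - (y ^ p)" using p(2) by simp
  finally have "(x - y) ^ p = x ^ p - y ^ p + of_nat p * (\<Sum>k\<in>{0<..<p}. of_nat (c k) * x ^ k * (- y) ^ (p - k))"
    by simp
  moreover have "(\<Sum>k\<in>{0<..<p}. of_nat (c k) * x ^ k * (- y) ^ (p - k)) \<in> A"
    using xy by (intro subring_sum[OF A] subring_mult[OF A] subring_power[OF A] subring_of_nat[OF A] subring_uminus[OF A])
  ultimately show ?thesis by blast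
qed

text \<open>Modulo \<open>p\<close> the map to \<open>p\<close>-th powers is a ring homomorphism,
  hence commutes with everything built from coordinates and 1.\<close>

lemma ipf_frobenius:
  assumes f: "f \<in> ipf s N" and A: "is_subring A" and a: "\<And>i j. i < s \<Longrightarrow> j \<le> N \<Longrightarrow> a (i, j) \<in> A"
    and p: "prime p" "odd p"
  shows "\<exists>c\<in>A. f (\<lambda>x. a x ^ p) = f a ^ p + of_nat p * c"
proof -
  have in_A: "g a \<in> A" if "g \<in> ipf s N" for g
    using that A by (rule ipf_in_subring) (rule a)
  show ?thesis
    using f
  proof induction
    case one
    then show ?case by (intro bexI[of _ 0] subring_0[OF A]) simp
  next
    case (var i j)
    then show ?case by (intro bexI[of _ 0] subring_0[OF A]) simp
  next
    case (diff f g)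
    then obtain c d where cd: "c \<in> A" "f (\<lambda>x. a x ^ p) = f a ^ p + of_nat p * c"
      "d \<in> A" "g (\<lambda>x. a x ^ p) = g a ^ p + of_nat p * d" by blast
    obtain e where e: "e \<in> A" "(f a - g a) ^ p = f a ^ p - g a ^ p + of_nat p * e"
      using freshman_diff[OF A in_A[OF diff.hyps(1)] in_A[OF diff.hyps(2)] p] by blast
    show ?case
      using cd e by (intro bexI[of _ "c - d - e"] subring_diff[OF A]) (simp_all add: algebra_simps)
  next
    case (mult f g)
    then obtain c d where cd: "c \<in> A" "f (\<lambda>x. a x ^ p) = f a ^ p + of_nat p * c"
      "d \<in> A" "g (\<lambda>x. a x ^ p) = g a ^ p + of_nat p * d" by blast
    have "f a ^ p \<in> A" "g a ^ p \<in> A" "of_nat p \<in> A"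
      using in_A mult.hyps
      by (auto intro: subring_power[OF A] subring_of_nat[OF A])
    then have "f a ^ p * d + c * g a ^ p + c * (of_nat p * d) \<in> A"
      using cd by (intro subring_add[OF A] subring_mult[OF A])
    moreover have "f (\<lambda>x. a x ^ p) * g (\<lambda>x. a x ^ p)
       = (f a * g a) ^ p + of_nat p * (f a ^ p * d + c * g a ^ p + c * (of_nat p * d))"
      by (simp add: cd power_mult_distrib algebra_simps)
    ultimately show ?case by blast
  qed
qed

section \<open>Linear systems whose entries are integer polynomial functions\<close>

definition ipf_module :: "nat \<Rightarrow> nat \<Rightarrow> ('e \<Rightarrow> (nat \<times> nat \<Rightarrow> 'k::comm_ring_1) \<Rightarrow> 'k) set \<Rightarrow> bool" where
  "ipf_module s N M \<longleftrightarrow>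
     (\<forall>r\<in>M. \<forall>e. r e \<in> ipf s N) \<and>
     (\<forall>r\<in>M. \<forall>r'\<in>M. (\<lambda>e a. r e a - r' e a) \<in> M) \<and>
     (\<forall>r\<in>M. \<forall>f\<in>ipf s N. (\<lambda>e a. f a * r e a) \<in> M)"

lemma ipf_module_sum:
  assumes M: "ipf_module s N M" and "r0 \<in> M" and r: "\<And>i. i \<in> X \<Longrightarrow> r i \<in> M"
  shows "(\<lambda>e a. \<Sum>i\<in>X. r i e a) \<in> M"
proof -
  have diff: "(\<lambda>e a. r e a - r' e a) \<in> M" if "r \<in> M" "r' \<in> M" for r r'
    using M that by (simp add: ipf_module_def)
  have zero: "(\<lambda>e a. 0) \<in> M" using diff[OF assms(2,2)] by simp
  have add: "(\<lambda>e a. r e a + r' e a) \<in> M" if "r \<in> M" "r' \<in> M" for r r'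
    using diff[OF that(1) diff[OF zero that(2)]] by simp
  show ?thesis
    using r by (induction X rule: infinite_finite_induct) (simp_all add: zero add)
qed

text \<open>Fraction-free Gaussian elimination: each pivot is chosen so that it does not vanish at \<open>b\<close>.\<close>

lemma ipf_elimination:
  fixes b :: "nat \<times> nat \<Rightarrow> 'k::field"
  assumes "finite E" "ipf_module s N M"
    and "\<And>v. (\<And>r. r \<in> M \<Longrightarrow> (\<Sum>e\<in>E. r e b * v e) = 0) \<Longrightarrow> \<forall>e\<in>E. v e = 0"
  shows "\<exists>\<delta>\<in>ipf s N. \<delta> b \<noteq> 0 \<and>
    (\<forall>e\<in>E. \<exists>r\<in>M. \<forall>e'\<in>E. r e' = (\<lambda>a. if e' = e then \<delta> a else 0))"
  using assms
proof (induction E arbitrary: M)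
  case empty
  then show ?case using ipf.one by (intro bexI[of _ "\<lambda>_. 1"]) auto
next
  case (insert e0 E)
  note M = insert.prems(1)
  have diff: "(\<lambda>e a. r e a - r' e a) \<in> M" if "r \<in> M" "r' \<in> M" for r r'
    using M that by (simp add: ipf_module_def)
  have smul: "(\<lambda>e a. f a * r e a) \<in> M" if "r \<in> M" "f \<in> ipf s N" for r f
    using M that by (simp add: ipf_module_def)
  have ent: "r e \<in> ipf s N" if "r \<in> M" for r e
    using M that by (simp add: ipf_module_def)
  \<comment> \<open>If column \<open>e0\<close> of every row vanished at \<open>b\<close>, the unit
    vector of \<open>e0\<close> would be a nonzero solution at \<open>b\<close>.\<close>
  obtain r0 where r0: "r0 \<in> M" "r0 e0 b \<noteq> 0"
  proof (rule ccontr)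
    assume "\<not> thesis"
    then have z: "r e0 b = 0" if "r \<in> M" for r using that \<open>\<And>r0. r0 \<in> M \<Longrightarrow> r0 e0 b \<noteq> 0 \<Longrightarrow> thesis\<close> by blast
    have "\<forall>e\<in>insert e0 E. (if e = e0 then 1 else 0 :: 'k) = 0"
    proof (rule insert.prems(2))
      fix r assume "r \<in> M"
      then show "(\<Sum>e\<in>insert e0 E. r e b * (if e = e0 then 1 else 0)) = 0"
        using z insert.hyps by (intro sum.neutral) auto
    qed
    then show False by simp
  qed
  define M' where "M' = {r \<in> M. \<forall>a. r e0 a = 0}"
  have "ipf_module s N M'"
    using M unfolding ipf_module_def M'_def by auto
  moreover have "\<forall>e\<in>E. v e = 0" if v: "\<And>r. r \<in> M' \<Longrightarrow> (\<Sum>e\<in>E. r e b * v e) = 0" for v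
  proof -
    \<comment> \<open>A solution \<open>v\<close> of the smaller system extends to the full one: the
      pivot row \<open>r0\<close> dictates the entry at \<open>e0\<close>.\<close>
    define w where "w e = (if e = e0 then - (\<Sum>e\<in>E. r0 e b * v e) / r0 e0 b else v e)" for e
    have split: "(\<Sum>e\<in>insert e0 E. r e b * w e) = r e0 b * w e0 + (\<Sum>e\<in>E. r e b * v e)" for r
    proof -
      have "(\<Sum>e\<in>E. r e b * w e) = (\<Sum>e\<in>E. r e b * v e)"
        using insert.hyps by (intro sum.cong) (auto simp: w_def)
      then show ?thesis using insert.hyps by simp
    qed
    have "\<forall>e\<in>insert e0 E. w e = 0"
    proof (rule insert.prems(2))
      fix r assume r: "r \<in> M"
      have "(\<lambda>e a. r0 e0 a * r e a - r e0 a * r0 e a) \<in> M"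
        using r r0 by (intro diff smul ent)
      then have "(\<lambda>e a. r0 e0 a * r e a - r e0 a * r0 e a) \<in> M'"
        by (simp add: M'_def)
      from v[OF this] have "r0 e0 b * (\<Sum>e\<in>E. r e b * v e) = r e0 b * (\<Sum>e\<in>E. r0 e b * v e)"
        by (simp add: left_diff_distrib sum_subtractf sum_distrib_left mult.assoc)
      then show "(\<Sum>e\<in>insert e0 E. r e b * w e) = 0"
        unfolding split using r0(2) by (simp add: w_def field_simps)
    qed
    then show ?thesis using insert.hyps by (auto simp: w_def split: if_splits)
  qed
  ultimately obtain \<delta> where \<delta>: "\<delta> \<in> ipf s N" "\<delta> b \<noteq> 0"
    "\<forall>e\<in>E. \<exists>r\<in>M'. \<forall>e'\<in>E. r e' = (\<lambda>a. if e' = e then \<delta> a else 0)"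
    using insert.IH[of M'] by blast
  then obtain R where R: "\<And>e. e \<in> E \<Longrightarrow> R e \<in> M'"
    "\<And>e e'. e \<in> E \<Longrightarrow> e' \<in> E \<Longrightarrow> R e e' = (\<lambda>a. if e' = e then \<delta> a else 0)" by metis
  have RM: "R e \<in> M" "R e e0 a = 0" if "e \<in> E" for e a
    using R(1)[OF that] by (auto simp: M'_def)
  show ?case
  proof (intro bexI[of _ "\<lambda>a. r0 e0 a * \<delta> a"] conjI ballI)
    show "(\<lambda>a. r0 e0 a * \<delta> a) \<in> ipf s N" using \<delta>(1) ent[OF r0(1)] by (intro ipf.mult)
    show "r0 e0 b * \<delta> b \<noteq> 0" using r0 \<delta> by simp
    fix e assume e: "e \<in> insert e0 E"
    show "\<exists>r\<in>M. \<forall>e'\<in>insert e0 E. r e' = (\<lambda>a. if e' = e then r0 e0 a * \<delta> a else 0)"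
    proof (cases "e = e0")
      case False
      then have e: "e \<in> E" using e by simp
      show ?thesis
        using smul[OF RM(1)[OF e] ent[OF r0(1), of e0]] RM(2)[OF e] R(2)[OF e] False insert.hyps
        by (intro bexI[of _ "\<lambda>e' a. r0 e0 a * R e e' a"]) auto
    next
      case True
      \<comment> \<open>The rows \<open>R e\<close> clear the columns in \<open>E\<close> of the
        scaled pivot row and leave column \<open>e0\<close> alone, where they are zero.\<close>
      define r where "r = (\<lambda>e' a. \<delta> a * r0 e' a - (\<Sum>e\<in>E. r0 e a * R e e' a))"
      have "r \<in> M"
        unfolding r_def
        by (intro diff[OF smul[OF r0(1) \<delta>(1)]] ipf_module_sum[OF M r0(1)] smul[OF RM(1) ent[OF r0(1)]])
      moreover have "r e0 = (\<lambda>a. r0 e0 a * \<delta> a)"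
        unfolding r_def by (simp add: RM(2) mult.commute)
      moreover have "r e' = (\<lambda>a. 0)" if "e' \<in> E" for e'
      proof
        fix a
        have "(\<Sum>e\<in>E. r0 e a * R e e' a) = (\<Sum>e\<in>E. if e = e' then r0 e a * \<delta> a else 0)"
          using that by (intro sum.cong) (auto simp: R(2))
        also have "\<dots> = r0 e' a * \<delta> a" using that insert.hyps by simp
        finally show "r e' a = 0" by (simp add: r_def mult.commute)
      qed
      ultimately show ?thesis using True insert.hyps by (intro bexI[of _ r]) auto
    qed
  qed
qed

text \<open>Coordinates beyond \<open>N\<close> are arbitrary in \<open>a\<close>; setting them to \<open>0\<close> keeps them in every subring.\<close>

definition pt :: "nat \<Rightarrow> (nat \<times> nat \<Rightarrow> 'k::comm_ring_1) \<Rightarrow> nat \<Rightarrow> nat \<Rightarrow> 'k" where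
  "pt N a i j = (if j \<le> N then a (i, j) else 0)"

lemma lookup_Var_mult:
  "lookup (Var v * g) m = (if v \<in> keys m then lookup g (m - single v 1) else 0)"
proof (cases "v \<in> keys m")
  case True
  then have "m = single v 1 + (m - single v 1)"
    by (intro poly_mapping_eqI) (auto simp: lookup_add lookup_minus lookup_single when_def in_keys_iff)
  then have "lookup (Var v * g) m = lookup (Var v * g) (single v 1 + (m - single v 1))" by simp
  also have "\<dots> = lookup g (m - single v 1)" by (simp only: Var_def lookup_single_mult mult_1)
  finally show ?thesis using True by simp
next
  case False
  then have "m \<noteq> single v 1 + m'" for m'
    by (auto simp: in_keys_iff lookup_add)
  from lookup_single_mult_0[of m "single v 1" 1 g, OF this] show ?thesis
    using False by (simp add: Var_def)
qed

text \<open>Expanding a monomial at a point gives integer polynomials in the coordinates of the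
  point; the induction multiplies by one factor \<open>Var v + Const (pt N a i v)\<close> at a
  time.\<close>

lemma lookup_shift_mon_ipf:
  "i < s \<Longrightarrow> (\<lambda>a. lookup (shift (pt N a i) (mon Var m)) n) \<in> ipf s N"
proof (induction m arbitrary: n rule: monomial_induct)
  case zero
  have "(\<lambda>a :: nat \<times> nat \<Rightarrow> 'a. lookup (1 :: (nat, 'a) mpoly) n) = (if n = 0 then (\<lambda>_. 1) else (\<lambda>_. 0))"
    by (auto simp: lookup_one)
  then show ?case by (simp add: ipf.one ipf_zero)
next
  case (add v m)
  have eq: "lookup (shift (pt N a i) (mon Var (single v 1 + m))) n
    = (if v \<in> keys n then lookup (shift (pt N a i) (mon Var m)) (n - single v 1) else 0)
      + pt N a i v * lookup (shift (pt N a i) (mon Var m)) n" for a :: "nat \<times> nat \<Rightarrow> 'a"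
    by (simp add: distrib_right lookup_add lookup_Var_mult)
  have "(\<lambda>a :: nat \<times> nat \<Rightarrow> 'a. pt N a i v) \<in> ipf s N"
    using add.prems by (cases "v \<le> N") (simp_all add: pt_def ipf.var ipf_zero)
  moreover have "(\<lambda>a :: nat \<times> nat \<Rightarrow> 'a. if v \<in> keys n then lookup (shift (pt N a i) (mon Var m)) (n - single v 1) else 0) \<in> ipf s N"
    using add by (cases "v \<in> keys n") (simp_all add: ipf_zero)
  ultimately show ?case
    unfolding eq using add by (intro ipf_add ipf.mult)
qed

lemma finite_monomials: "finite V \<Longrightarrow> finite {m :: 'v \<Rightarrow>\<^sub>0 nat. keys m \<subseteq> V \<and> mdeg m \<le> d}"
proof (induction d)
  case (Suc d)
  let ?F = "{m :: 'v \<Rightarrow>\<^sub>0 nat. keys m \<subseteq> V \<and> mdeg m \<le> d}"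
  have "m \<in> insert 0 (\<Union>v\<in>V. (+) (single v 1) ` ?F)" if "keys m \<subseteq> V" "mdeg m \<le> Suc d" for m
  proof (cases m rule: monomial_cases)
    case (2 v n)
    then have "n \<in> ?F" "v \<in> V" using that by auto
    then show ?thesis using 2(1) by blast
  qed simp
  then have "{m :: 'v \<Rightarrow>\<^sub>0 nat. keys m \<subseteq> V \<and> mdeg m \<le> Suc d} \<subseteq> insert 0 (\<Union>v\<in>V. (+) (single v 1) ` ?F)"
    by blast
  then show ?case using Suc by (elim finite_subset) auto
qed simp

text \<open>The generating rows are the linear conditions on the coefficients of a polynomial that say that
  each homogeneous component vanishes to order \<open>m\<close> at the points.\<close>

inductive_set cond_rows :: "nat \<Rightarrow> nat \<Rightarrow> nat \<Rightarrow> ((nat \<Rightarrow>\<^sub>0 nat) \<Rightarrow> (nat \<times> nat \<Rightarrow> 'k::comm_ring_1) \<Rightarrow> 'k) set"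
  for s N m where
  cond: "i < s \<Longrightarrow> mdeg \<gamma> < m \<Longrightarrow>
    (\<lambda>\<beta> a. if mdeg \<beta> = j then lookup (shift (pt N a i) (mon Var \<beta>)) \<gamma> else 0) \<in> cond_rows s N m"
| diff: "r \<in> cond_rows s N m \<Longrightarrow> r' \<in> cond_rows s N m \<Longrightarrow> (\<lambda>e a. r e a - r' e a) \<in> cond_rows s N m"
| smul: "r \<in> cond_rows s N m \<Longrightarrow> f \<in> ipf s N \<Longrightarrow> (\<lambda>e a. f a * r e a) \<in> cond_rows s N m"

lemma cond_rows_module: "ipf_module s N (cond_rows s N m)"
proof -
  have "r e \<in> ipf s N" if "r \<in> cond_rows s N m" for r :: "_ \<Rightarrow> (nat \<times> nat \<Rightarrow> 'a) \<Rightarrow> 'a" and e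
    using that
  proof (induction arbitrary: e)
    case (cond i \<gamma> j)
    then show ?case using lookup_shift_mon_ipf[of i s N e \<gamma>] by (cases "mdeg e = j") (simp_all add: ipf_zero)
  qed (intro ipf.diff ipf.mult; simp)+
  then show ?thesis
    unfolding ipf_module_def by (auto intro: cond_rows.diff cond_rows.smul)
qed

lemma sum_lookup_shift:
  assumes "finite E"
  shows "(\<Sum>\<beta>\<in>E. (if mdeg \<beta> = j then lookup (shift P (mon Var \<beta>)) \<gamma> else 0) * v \<beta>)
    = lookup (shift P (\<Sum>\<beta>\<in>{\<beta>\<in>E. mdeg \<beta> = j}. single \<beta> (v \<beta>))) \<gamma>"
proof -
  have "lookup (shift P (\<Sum>\<beta>\<in>{\<beta>\<in>E. mdeg \<beta> = j}. single \<beta> (v \<beta>))) \<gamma>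
    = (\<Sum>\<beta>\<in>{\<beta>\<in>E. mdeg \<beta> = j}. lookup (shift P (mon Var \<beta>)) \<gamma> * v \<beta>)"
    by (simp add: lookup_sum single_eq_Const_mon mult.commute)
  also have "\<dots> = (\<Sum>\<beta>\<in>E. if mdeg \<beta> = j then lookup (shift P (mon Var \<beta>)) \<gamma> * v \<beta> else 0)"
    using assms by (simp add: sum.inter_filter)
  finally show ?thesis by (simp add: if_distrib[of "\<lambda>x. x * _"] cong: if_cong)
qed

text \<open>A lower bound \<open>D\<close> for the degrees of nonzero forms in a symbolic power,
  phrased through orders at affine representatives so that it becomes linear in the
  coefficients.\<close>

definition no_forms_below :: "nat \<Rightarrow> nat \<Rightarrow> nat \<Rightarrow> nat \<Rightarrow> (nat \<times> nat \<Rightarrow> 'k::comm_ring_1) \<Rightarrow> bool" where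
  "no_forms_below s N m D a \<longleftrightarrow> (\<forall>f\<in>polyring N. \<forall>e<D. homogeneous e f \<longrightarrow>
     (\<forall>i<s. ord_ge m (shift (pt N a i) f)) \<longrightarrow> f = 0)"

text \<open>A function \<open>\<delta>\<close> that witnesses \<open>no_forms_below\<close> wherever it does not vanish, and does so
  modulo every ideal \<open>I\<close> of every subring \<open>A\<close> containing the coordinates of the points.\<close>

definition forms_certificate ::
    "nat \<Rightarrow> nat \<Rightarrow> nat \<Rightarrow> nat \<Rightarrow> ((nat \<times> nat \<Rightarrow> 'k::comm_ring_1) \<Rightarrow> 'k) \<Rightarrow> bool" where
  "forms_certificate s N m D \<delta> \<longleftrightarrow> \<delta> \<in> ipf s N \<and>
    (\<forall>A I a v e \<beta>. is_subring A \<longrightarrow> (\<forall>x\<in>I. \<forall>y\<in>I. x - y \<in> I) \<longrightarrow> (\<forall>x\<in>A. \<forall>y\<in>I. x * y \<in> I) \<longrightarrow> 0 \<in> I \<longrightarrow>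
      (\<forall>i<s. \<forall>j\<le>N. a (i, j) \<in> A) \<longrightarrow> v \<in> polyring N \<longrightarrow> homogeneous e v \<longrightarrow> e < D \<longrightarrow>
      (\<forall>i<s. \<forall>\<gamma>. mdeg \<gamma> < m \<longrightarrow> lookup (shift (pt N a i) v) \<gamma> \<in> I) \<longrightarrow> \<delta> a * lookup v \<beta> \<in> I)"

text \<open>At \<open>b\<close> the vanishing conditions have only the trivial solution, so
  elimination combines them to \<open>\<delta>\<close> times a single coefficient with
  \<open>\<delta> b \<noteq> 0\<close>. The combinations have integer polynomial coefficients, so
  they can be applied to conditions that hold only modulo \<open>I\<close>.\<close>

lemma no_forms_below_certificate:
  fixes b :: "nat \<times> nat \<Rightarrow> 'k::field"
  assumes "no_forms_below s N m D b"
  shows "\<exists>\<delta>. forms_certificate s N m D \<delta> \<and> \<delta> b \<noteq> 0"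
proof -
  define E where "E = {\<beta> :: nat \<Rightarrow>\<^sub>0 nat. keys \<beta> \<subseteq> {..N} \<and> mdeg \<beta> < D}"
  have fE: "finite E"
    by (rule finite_subset[OF _ finite_monomials[of "{..N}" D]]) (auto simp: E_def)
  have "\<forall>\<beta>\<in>E. v \<beta> = 0" if v: "\<And>r. r \<in> cond_rows s N m \<Longrightarrow> (\<Sum>\<beta>\<in>E. r \<beta> b * v \<beta>) = 0" for v
  proof
    fix \<beta> assume \<beta>: "\<beta> \<in> E"
    define f where "f = (\<Sum>\<beta>'\<in>{\<beta>'\<in>E. mdeg \<beta>' = mdeg \<beta>}. single \<beta>' (v \<beta>'))"
    have lf: "lookup f k = (if k \<in> E \<and> mdeg k = mdeg \<beta> then v k else 0)" for k
      unfolding f_def lookup_sum lookup_single when_def using fE by simp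
    have "k \<in> E" if "k \<in> keys f" for k
      using that by (simp add: in_keys_iff lf split: if_splits)
    then have "f \<in> polyring N"
      by (auto simp: polyring_def E_def)
    moreover have "homogeneous (mdeg \<beta>) f"
      by (auto simp: homogeneous_iff in_keys_iff lf split: if_splits)
    moreover have "mdeg \<beta> < D" using \<beta> by (simp add: E_def)
    moreover have "ord_ge m (shift (pt N b i) f)" if "i < s" for i
      unfolding ord_ge_iff_lookup
      using v[OF cond_rows.cond[OF that, of _ m "mdeg \<beta>"]] sum_lookup_shift[OF fE, of "mdeg \<beta>" "pt N b i" _ v]
      by (auto simp: f_def)
    ultimately have "f = 0" using assms unfolding no_forms_below_def by blast
    then show "v \<beta> = 0" using lf[of \<beta>] \<beta> by simp
  qed
  from ipf_elimination[OF fE cond_rows_module this]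
  obtain \<delta> where \<delta>: "\<delta> \<in> ipf s N" "\<delta> b \<noteq> 0"
    "\<forall>e\<in>E. \<exists>r\<in>cond_rows s N m. \<forall>e'\<in>E. r e' = (\<lambda>a. if e' = e then \<delta> a else 0)" by blast
  have "forms_certificate s N m D \<delta>"
    unfolding forms_certificate_def
  proof (intro conjI allI impI \<delta>(1))
    fix A I :: "'k set" and a v e \<beta>
    assume A: "is_subring A" and I: "\<forall>x\<in>I. \<forall>y\<in>I. x - y \<in> I" "\<forall>x\<in>A. \<forall>y\<in>I. x * y \<in> I" "0 \<in> I"
      and a: "\<forall>i<s. \<forall>j\<le>N. a (i, j) \<in> A" and v: "v \<in> polyring N" "homogeneous e v" "e < D"
      "\<forall>i<s. \<forall>\<gamma>. mdeg \<gamma> < m \<longrightarrow> lookup (shift (pt N a i) v) \<gamma> \<in> I"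
    have vE: "keys v \<subseteq> E" using v by (auto simp: E_def polyring_def homogeneous_iff)
    \<comment> \<open>True for the generating conditions by assumption on \<open>v\<close>, and
      inherited because multipliers take values in \<open>A\<close>.\<close>
    have rows: "(\<Sum>\<beta>\<in>E. r \<beta> a * lookup v \<beta>) \<in> I" if "r \<in> cond_rows s N m" for r
      using that
    proof induction
      case (cond i \<gamma> j)
      have "(\<Sum>\<beta>\<in>{\<beta>\<in>E. mdeg \<beta> = j}. single \<beta> (lookup v \<beta>)) = hcomp j v"
      proof (rule poly_mapping_eqI)
        fix k
        show "lookup (\<Sum>\<beta>\<in>{\<beta>\<in>E. mdeg \<beta> = j}. single \<beta> (lookup v \<beta>)) k = lookup (hcomp j v) k"
          unfolding lookup_sum lookup_single lookup_hcomp when_def using fE vE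
          by (auto simp: in_keys_iff)
      qed
      then show ?case
        unfolding sum_lookup_shift[OF fE] hcomp_homogeneous[OF v(2)]
        using v(4) cond I by simp
    next
      case (diff r r')
      then show ?case using I(1) by (simp add: left_diff_distrib sum_subtractf)
    next
      case (smul r f)
      have "f a \<in> A" using a by (intro ipf_in_subring[OF smul.hyps(2) A]) auto
      then show ?case using I(2) smul by (simp add: mult.assoc flip: sum_distrib_left)
    qed
    show "\<delta> a * lookup v \<beta> \<in> I"
    proof (cases "\<beta> \<in> E")
      case True
      then obtain r where r: "r \<in> cond_rows s N m" "\<And>e'. e' \<in> E \<Longrightarrow> r e' = (\<lambda>a. if e' = \<beta> then \<delta> a else 0)"
        using \<delta>(3) by blast
      have "(\<Sum>\<beta>'\<in>E. r \<beta>' a * lookup v \<beta>') = (\<Sum>\<beta>'\<in>E. if \<beta>' = \<beta> then \<delta> a * lookup v \<beta>' else 0)"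
        by (intro sum.cong) (auto simp: r(2))
      also have "\<dots> = \<delta> a * lookup v \<beta>" using True fE by simp
      finally show ?thesis using rows[OF r(1)] by simp
    next
      case False
      then have "lookup v \<beta> = 0" using vE by (auto simp: in_keys_iff)
      then show ?thesis using I by simp
    qed
  qed
  then show ?thesis using \<delta>(2) by blast
qed

subsection \<open>Frobenius splitting modulo a prime\<close>

definition mscale :: "nat \<Rightarrow> ('v \<Rightarrow>\<^sub>0 nat) \<Rightarrow> ('v \<Rightarrow>\<^sub>0 nat)" where
  "mscale p = Poly_Mapping.map ((*) p)"
definition mdiv :: "nat \<Rightarrow> ('v \<Rightarrow>\<^sub>0 nat) \<Rightarrow> ('v \<Rightarrow>\<^sub>0 nat)" where
  "mdiv p = Poly_Mapping.map (\<lambda>n. n div p)"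
definition mmod :: "nat \<Rightarrow> ('v \<Rightarrow>\<^sub>0 nat) \<Rightarrow> ('v \<Rightarrow>\<^sub>0 nat)" where
  "mmod p = Poly_Mapping.map (\<lambda>n. n mod p)"

lemma lookup_mscale [simp]: "lookup (mscale p m) v = p * lookup m v"
  by (simp add: mscale_def Poly_Mapping.map.rep_eq when_def)
lemma lookup_mdiv [simp]: "lookup (mdiv p m) v = lookup m v div p"
  by (simp add: mdiv_def Poly_Mapping.map.rep_eq when_def)
lemma lookup_mmod [simp]: "lookup (mmod p m) v = lookup m v mod p"
  by (simp add: mmod_def Poly_Mapping.map.rep_eq when_def)

lemma mmod_mdiv: "mmod p m + mscale p (mdiv p m) = m"
  by (rule poly_mapping_eqI) (simp add: lookup_add)

lemma mscale_add: "mscale p (m + n) = mscale p m + mscale p n"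
  by (rule poly_mapping_eqI) (simp add: lookup_add algebra_simps)

lemma mscale_single: "mscale p (single v n) = single v (p * n)"
  by (rule poly_mapping_eqI) (simp add: lookup_single when_def)

lemma mscale_0 [simp]: "mscale p 0 = 0"
  by (rule poly_mapping_eqI) simp

lemma keys_mscale: "p > 0 \<Longrightarrow> keys (mscale p m) = keys m"
  by (auto simp: in_keys_iff)

lemma mdeg_mscale: "mdeg (mscale p m) = p * mdeg m"
  by (induction m rule: monomial_induct) (simp_all add: mscale_add mscale_single distrib_left)

lemma mon_mscale: "mon y (mscale p m) = mon (\<lambda>v. y v ^ p) m"
  by (induction m rule: monomial_induct) (simp_all add: mscale_add mscale_single)

lemma mscale_inject: "p > 0 \<Longrightarrow> mscale p m = mscale p n \<longleftrightarrow> m = n"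
  by (auto simp: poly_mapping_eq_iff fun_eq_iff)

text \<open>Writing \<open>h = (\<Sum>b. x\<^sup>b h\<^sub>b(x\<^sup>p))\<close> with all exponents of \<open>b\<close> below \<open>p\<close>, this is \<open>h\<^sub>b\<close>.\<close>

definition frob_part :: "nat \<Rightarrow> ('v \<Rightarrow>\<^sub>0 nat) \<Rightarrow> ('v, 'k::comm_ring_1) mpoly \<Rightarrow> ('v, 'k) mpoly" where
  "frob_part p b h = Abs_poly_mapping (\<lambda>c. if p = 0 then 0 else lookup h (b + mscale p c))"

lemma lookup_frob_part: "p > 0 \<Longrightarrow> lookup (frob_part p b h) c = lookup h (b + mscale p c)"
proof -
  assume p: "p > 0"
  have "inj_on (\<lambda>c. b + mscale p c) UNIV"
    using p by (auto simp: inj_on_def mscale_inject)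
  moreover have "finite ((\<lambda>c. b + mscale p c) ` {c. lookup h (b + mscale p c) \<noteq> 0})"
    by (rule finite_subset[OF _ finite_keys[of h]]) (auto simp: in_keys_iff)
  ultimately have "finite {c. lookup h (b + mscale p c) \<noteq> 0}"
    using finite_imageD inj_on_subset[OF _ subset_UNIV] by blast
  then show ?thesis using p by (simp add: frob_part_def)
qed

lemma frob_part_add: "p > 0 \<Longrightarrow> frob_part p b (f + g) = frob_part p b f + frob_part p b g"
  by (rule poly_mapping_eqI) (simp add: lookup_frob_part lookup_add)

lemma frob_part_0: "p > 0 \<Longrightarrow> frob_part p b 0 = 0"
  by (rule poly_mapping_eqI) (simp add: lookup_frob_part)

lemma lookup_of_nat_mult:
  fixes g :: "('v, 'k::comm_ring_1) mpoly"
  shows "lookup (of_nat n * g) m = of_nat n * lookup g m"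
  using lookup_Const_mult[of "of_nat n" g m] by (simp only: Const_of_nat)

lemma shift_of_nat [simp]: "shift P (of_nat n) = of_nat n"
  using shift_simps(5)[of P "of_nat n"] by (simp only: Const_of_nat)

lemma frob_part_of_nat_mult: "p > 0 \<Longrightarrow> frob_part p b (of_nat n * g) = of_nat n * frob_part p b g"
  by (rule poly_mapping_eqI) (simp add: lookup_frob_part lookup_of_nat_mult)

lemma frob_part_in_coeffs_in: "p > 0 \<Longrightarrow> h \<in> coeffs_in A \<Longrightarrow> frob_part p b h \<in> coeffs_in A"
  by (simp add: coeffs_in_def lookup_frob_part)

lemma frob_part_in_polyring: "p > 0 \<Longrightarrow> h \<in> polyring N \<Longrightarrow> frob_part p b h \<in> polyring N"
  unfolding polyring_def
proof safe
  fix m v assume p: "p > 0" and h: "\<forall>m\<in>keys h. keys m \<subseteq> {..N}" and m: "m \<in> keys (frob_part p b h)" "v \<in> keys m"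
  have "b + mscale p m \<in> keys h" using m(1) p by (simp add: in_keys_iff lookup_frob_part)
  moreover have "v \<in> keys (b + mscale p m)" using m(2) p by (simp add: keys_add_nat keys_mscale)
  ultimately show "v \<le> N" using h by blast
qed

lemma frob_part_homogeneous:
  assumes p: "p > 0" and "homogeneous e h"
  shows "homogeneous ((e - mdeg b) div p) (frob_part p b h)"
  unfolding homogeneous_iff
proof
  fix m assume "m \<in> keys (frob_part p b h)"
  then have "b + mscale p m \<in> keys h" using p by (simp add: in_keys_iff lookup_frob_part)
  then have "mdeg (b + mscale p m) = e" using assms by (simp only: homogeneous_iff)
  then have "e = mdeg b + p * mdeg m" by (simp add: mdeg_mscale)
  then show "mdeg m = (e - mdeg b) div p" using p by simp
qed

text \<open>A factor with exponents divisible by \<open>p\<close> leaves the residues of exponents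
  unchanged and adds \<open>n\<close> to the quotients; \<open>b\<close> is a residue because its
  entries are below \<open>p\<close>.\<close>

lemma frob_part_single_mult:
  assumes p: "p > 0" and b: "\<And>v. lookup b v < p"
  shows "frob_part p b (single m c * single (mscale p n) d) = frob_part p b (single m c) * single n d"
proof (rule poly_mapping_eqI)
  fix e
  have *: "m = b + mscale p (mdiv p m)" if "m + mscale p n = b + mscale p e" for n e
  proof (rule poly_mapping_eqI)
    fix v
    have "lookup m v + p * lookup n v = lookup b v + p * lookup e v"
      using arg_cong[OF that, of "\<lambda>u. lookup u v"] by (simp add: lookup_add)
    then have "(lookup m v + p * lookup n v) mod p = (lookup b v + p * lookup e v) mod p" by simp
    then have "lookup m v mod p = lookup b v" using b[of v] by simp
    then show "lookup m v = lookup (b + mscale p (mdiv p m)) v"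
      using mod_mult_div_eq[of "lookup m v" p] by (simp add: lookup_add)
  qed
  show "lookup (frob_part p b (single m c * single (mscale p n) d)) e
      = lookup (frob_part p b (single m c) * single n d) e"
  proof (cases "\<exists>m'. m = b + mscale p m'")
    case True
    then obtain m' where m': "m = b + mscale p m'" by blast
    have "frob_part p b (single m c) = single m' c"
      by (rule poly_mapping_eqI) (use p in \<open>auto simp: lookup_frob_part lookup_single when_def m' mscale_inject\<close>)
    then show ?thesis
      using p by (simp add: lookup_frob_part mult_single lookup_single m' add.assoc mscale_inject flip: mscale_add)
  next
    case False
    then have "frob_part p b (single m c) = 0"
      using p by (intro poly_mapping_eqI) (auto simp: lookup_frob_part lookup_single when_def)
    moreover have "m + mscale p n \<noteq> b + mscale p e" using * False by blast
    ultimately show ?thesis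
      using p by (simp add: lookup_frob_part mult_single lookup_single)
  qed
qed

text \<open>Taking a Frobenius part is linear over the polynomials in the \<open>p\<close>-th powers
  of the variables.\<close>

lemma frob_part_mult:
  assumes p: "p > 0" and b: "\<And>v. lookup b v < p"
  shows "frob_part p b (u * subst (\<lambda>v. Var v ^ p) g) = frob_part p b u * g"
proof (induction u rule: mpoly_induct)
  case (single m c)
  show ?case
  proof (induction g rule: mpoly_induct)
    case (single n d)
    have "subst (\<lambda>v. Var v ^ p) (single n d) = single (mscale p n) d"
      by (simp add: single_eq_Const_mon mon_mscale subst_mon)
    then show ?case using frob_part_single_mult[OF p b] by simp
  qed (simp add: distrib_left frob_part_add[OF p])
qed (simp add: distrib_right frob_part_add[OF p])

lemma mon_congruence:
  assumes A: "is_subring A" and zw: "\<And>v. z v \<in> A" "\<And>v. w v \<in> A"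
  shows "\<exists>W\<in>A. mon (\<lambda>v. z v + of_nat p * w v) m = mon z m + of_nat p * W"
proof (induction m rule: monomial_induct)
  case zero
  show ?case by (intro bexI[of _ 0] subring_0[OF A]) simp
next
  case (add v m)
  then obtain W where W: "W \<in> A" "mon (\<lambda>v. z v + of_nat p * w v) m = mon z m + of_nat p * W" by blast
  have "z v * W + w v * mon z m + of_nat p * (w v * W) \<in> A"
    using W zw by (intro subring_add[OF A] subring_mult[OF A] subring_mon[OF A] subring_of_nat[OF A])
  moreover have "mon (\<lambda>v. z v + of_nat p * w v) (single v 1 + m)
     = mon z (single v 1 + m) + of_nat p * (z v * W + w v * mon z m + of_nat p * (w v * W))"
    by (simp add: W(2) algebra_simps)
  ultimately show ?case by blast
qed

lemma subst_in_polyring': "f \<in> polyring N \<Longrightarrow> (\<And>v. v \<le> N \<Longrightarrow> x v \<in> polyring M) \<Longrightarrow> subst x f \<in> polyring M"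
proof -
  assume f: "f \<in> polyring N" and x: "\<And>v. v \<le> N \<Longrightarrow> x v \<in> polyring M"
  have "subst (\<lambda>v. if v \<le> N then x v else 0) f \<in> polyring M"
    using x by (intro subst_in_polyring) (simp add: subring_0[OF polyring_subring])
  also have "subst (\<lambda>v. if v \<le> N then x v else 0) f = subst x f"
    using f by (rule subst_polyring_cong) simp
  finally show ?thesis .
qed

lemma mdeg_mmod_le:
  assumes "keys m \<subseteq> {..N}" "p > 0"
  shows "mdeg (mmod p m) \<le> (N + 1) * (p - 1)"
proof -
  have "keys (mmod p m) \<subseteq> {..N}" 
  proof
    fix v assume "v \<in> keys (mmod p m)"
    then have "v \<in> keys m" by (cases "lookup m v = 0") (simp_all add: in_keys_iff)
    then show "v \<in> {..N}" using assms(1) by blast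
  qed
  then have "mdeg (mmod p m) = (\<Sum>v\<le>N. lookup m v mod p)"
    by (subst mdeg_superset[of "{..N}"]) auto
  also have "\<dots> \<le> (\<Sum>v\<le>N. p - 1)"
  proof (rule sum_mono)
    fix v
    have "lookup m v mod p < p" using assms(2) by simp
    then show "lookup m v mod p \<le> p - 1" by linarith
  qed
  finally show ?thesis by simp
qed

text \<open>The pigeonhole step: the \<open>N + 1\<close> residues add up to at most
  \<open>(N + 1) * (p - 1)\<close>, so a quotient of degree below \<open>k\<close> would leave
  \<open>mdeg m\<close> below \<open>p * (N + k)\<close>.\<close>

lemma mdeg_mdiv_ge:
  assumes "keys m \<subseteq> {..N}" "p > 0" "p * (N + k) \<le> mdeg m"
  shows "k \<le> mdeg (mdiv p m)"
proof (rule ccontr)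
  assume "\<not> k \<le> mdeg (mdiv p m)"
  then have "mdeg (mdiv p m) + 1 \<le> k" by simp
  then have "p * (mdeg (mdiv p m) + 1) \<le> p * k" by (rule mult_le_mono2)
  moreover have "mdeg m = mdeg (mmod p m) + p * mdeg (mdiv p m)"
    using arg_cong[OF mmod_mdiv[of p m], of mdeg] by (simp add: mdeg_mscale)
  moreover have "mdeg (mmod p m) \<le> (N + 1) * (p - 1)" using assms by (intro mdeg_mmod_le)
  moreover have "(N + 1) * (p - 1) + N + 1 = N * p + p"
    using assms(2) by (cases p) (simp_all add: algebra_simps)
  ultimately show False using assms(3) by (simp add: algebra_simps)
qed

text \<open>In the expansion at \<open>P\<close>, every monomial is a residue part times the
  \<open>p\<close>-th power of a monomial of degree at least \<open>k\<close>. Modulo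
  \<open>p\<close>, that power is a polynomial in the \<open>p\<close>-th powers of the variables
  and can be pulled out of the Frobenius part.\<close>

lemma frobenius_vanishing:
  fixes P :: "nat \<Rightarrow> 'k::comm_ring_1"
  assumes A: "is_subring A" and p: "prime p" "odd p" and P: "\<And>v. P v \<in> A"
    and h: "h \<in> coeffs_in A" "h \<in> polyring N" and ord: "ord_ge (p * (N + k)) (shift P h)"
    and b: "\<And>v. lookup b v < p" and \<gamma>: "mdeg \<gamma> < k"
  shows "\<exists>c\<in>A. lookup (shift (\<lambda>v. P v ^ p) (frob_part p b h)) \<gamma> = of_nat p * c"
proof -
  let ?R = "coeffs_in A :: (nat, 'k) mpoly set" and ?sh = "shift (\<lambda>v. P v ^ p)"
  note R = coeffs_in_subring[OF A, where 'v = nat]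
  have p0: "p > 0" using p by (simp add: prime_gt_0_nat)
  have CP: "Const (P v) \<in> ?R" "Const (P v ^ p) \<in> ?R" "Var v \<in> ?R" for v
    using P by (auto intro: Const_in_coeffs_in Var_in_coeffs_in A subring_power)
  \<comment> \<open>Modulo \<open>p\<close>, \<open>y v ^ p\<close> is \<open>z v\<close>, and
    \<open>z v\<close> arises from \<open>y' v\<close> by \<open>Var v ^ p\<close> for
    \<open>Var v\<close>. So \<open>y'\<close> belongs to the point with coordinates
    \<open>P v ^ p\<close> as \<open>y\<close> belongs to \<open>P\<close>.\<close>
  define y where "y v = Var v - Const (P v)" for v
  define z where "z v = Var v ^ p - Const (P v ^ p)" for v
  define y' where "y' v = Var v - Const (P v ^ p)" for v
  have "\<exists>c\<in>?R. y v ^ p = z v + of_nat p * c" for v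
    unfolding y_def z_def Const_power using freshman_diff[OF R CP(3,1) p] by blast
  then obtain w where w: "\<And>v. w v \<in> ?R" "\<And>v. y v ^ p = z v + of_nat p * w v" by metis
  have yR: "y v \<in> ?R" "y' v \<in> ?R" "z v \<in> ?R" for v
    unfolding y_def y'_def z_def by (intro subring_diff[OF R] subring_power[OF R] CP)+
  define H where "H = shift P h"
  have HR: "H \<in> ?R" unfolding H_def shift_def
    using h by (intro subst_in_coeffs_in A subring_add[OF R] CP)
  have HN: "H \<in> polyring N" unfolding H_def shift_def
    by (rule subst_in_polyring'[OF h(2)]) (intro subring_add[OF polyring_subring] Var_in_polyring Const_in_polyring)
  \<comment> \<open>Vanishing up to multiples of \<open>p\<close>, in a form stable under sums, so
    that it can be checked term by term in the expansion at \<open>P\<close>.\<close>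
  define good where "good g \<longleftrightarrow> (\<exists>G. \<exists>W\<in>?R. frob_part p b g = G + of_nat p * W \<and> ord_ge k (?sh G))" for g
  have good_0: "good 0"
    unfolding good_def using subring_0[OF R] frob_part_0[OF p0, of b] by (intro exI[of _ 0] bexI[of _ 0]) simp_all
  have good_add: "good (f + g)" if f: "good f" and g: "good g" for f g
  proof -
    obtain F V where F: "V \<in> ?R" "frob_part p b f = F + of_nat p * V" "ord_ge k (?sh F)"
      using f unfolding good_def by blast
    obtain G W where G: "W \<in> ?R" "frob_part p b g = G + of_nat p * W" "ord_ge k (?sh G)"
      using g unfolding good_def by blast
    show ?thesis unfolding good_def
      using F G by (intro exI[of _ "F + G"] bexI[of _ "V + W"] subring_add[OF R])
        (simp_all add: frob_part_add[OF p0] algebra_simps ord_ge_add)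
  qed
  have good_sum: "good (\<Sum>m\<in>X. g m)" if "\<And>m. m \<in> X \<Longrightarrow> good (g m)" for X and g :: "(nat \<Rightarrow>\<^sub>0 nat) \<Rightarrow> _"
    using that by (induction X rule: infinite_finite_induct) (simp_all add: good_0 good_add)
  have good_term: "good (Const (lookup H m) * mon y m)" if m: "m \<in> keys H" for m
  proof -
    let ?q = "mdiv p m"
    obtain W where W: "W \<in> ?R" "mon (\<lambda>v. z v + of_nat p * w v) ?q = mon z ?q + of_nat p * W"
      using mon_congruence[OF R, of z w p ?q] yR(3) w(1) by blast
    define t where "t = Const (lookup H m) * mon y (mmod p m)"
    have tR: "t \<in> ?R" unfolding t_def
      using HR by (intro subring_mult[OF R] subring_mon[OF R] yR Const_in_coeffs_in A) (simp add: coeffs_in_def)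
    have "mon y m = mon y (mmod p m) * mon (\<lambda>v. z v + of_nat p * w v) ?q"
      using arg_cong[OF mmod_mdiv[of p m], of "mon y"] by (simp add: mon_mscale w(2))
    moreover have "mon z ?q = subst (\<lambda>v. Var v ^ p) (mon y' ?q)"
      unfolding subst_mon by (simp add: z_def[abs_def] y'_def)
    ultimately have "Const (lookup H m) * mon y m
        = t * subst (\<lambda>v. Var v ^ p) (mon y' ?q) + of_nat p * (t * W)"
      by (simp add: t_def W(2) algebra_simps)
    then have "frob_part p b (Const (lookup H m) * mon y m)
        = frob_part p b t * mon y' ?q + of_nat p * frob_part p b (t * W)"
      by (simp add: frob_part_add[OF p0] frob_part_mult[OF p0 b] frob_part_of_nat_mult[OF p0])
    moreover have "frob_part p b (t * W) \<in> ?R"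
      using tR W(1) by (intro frob_part_in_coeffs_in p0 subring_mult[OF R])
    moreover have "ord_ge k (?sh (frob_part p b t * mon y' ?q))"
    proof -
      have "?sh (mon y' ?q) = mon Var ?q"
        by (simp add: shift_def subst_mon y'_def)
      moreover have "keys m \<subseteq> {..N}" using HN m by (auto simp: polyring_def)
      moreover have "p * (N + k) \<le> mdeg m" using ord m by (simp add: H_def ord_ge_def)
      ultimately show ?thesis
        using mdeg_mdiv_ge[of m N p k] p0 homogeneous_mon[of Var ?q] homogeneous_Var
        by (auto intro!: ord_ge_mult_left intro: ord_ge_homogeneous)
    qed
    ultimately show ?thesis unfolding good_def by blast
  qed
  have "h = subst y H"
    unfolding H_def shift_def subst_subst by (simp add: y_def)
  also have "\<dots> = (\<Sum>m\<in>keys H. Const (lookup H m) * mon y m)" by (simp add: subst_def)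
  finally have "good h" using good_sum[OF good_term] by simp
  then obtain G W where GW: "W \<in> ?R" "frob_part p b h = G + of_nat p * W" "ord_ge k (?sh G)"
    unfolding good_def by blast
  have "?sh W \<in> ?R" unfolding shift_def
    using GW(1) by (intro subst_in_coeffs_in A subring_add[OF R] CP)
  moreover have "lookup (?sh (frob_part p b h)) \<gamma> = of_nat p * lookup (?sh W) \<gamma>"
    using GW(3) \<gamma>
    by (simp add: GW(2) lookup_add ord_ge_iff_lookup lookup_of_nat_mult)
  ultimately show ?thesis unfolding coeffs_in_def by blast
qed

text \<open>If the inequality failed, a power of \<open>f\<close> would force every large prime to become a unit
  in a finitely generated ring.\<close>

theorem degree_lower_bound:
  fixes a :: "nat \<times> nat \<Rightarrow> 'k::field_char_0"
  assumes cert: "forms_certificate s N m D \<delta>" and \<delta>a: "\<delta> a \<noteq> 0"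
    and f: "f \<in> polyring N" "f \<noteq> 0" "homogeneous e f" and n: "n \<ge> 1"
    and ord: "\<And>i. i < s \<Longrightarrow> ord_ge n (shift (pt N a i) f)"
  shows "n * D \<le> e * (N + m)"
proof (rule ccontr)
  assume "\<not> n * D \<le> e * (N + m)"
  then have less: "e * (N + m) + 1 \<le> n * D" by simp
  have \<delta>: "\<delta> \<in> ipf s N" using cert by (simp add: forms_certificate_def)
  define S where "S = lookup f ` keys f \<union> a ` ({..<s} \<times> {..N})"
  define A where "A = zring S"
  have A: "is_subring A" unfolding A_def by (rule zring_subring)
  have aA: "a (i, j) \<in> A" if "i < s" "j \<le> N" for i j
    unfolding A_def using zring_superset[of S] that by (auto simp: S_def)
  have fA: "f \<in> coeffs_in A"
  proof -
    have "lookup f k \<in> A" for k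
      using zring_superset[of S] subring_0[OF A] by (cases "k \<in> keys f") (auto simp: S_def A_def in_keys_iff)
    then show ?thesis by (simp add: coeffs_in_def)
  qed
  \<comment> \<open>The ring A[x], again finitely generated. The bound on unit primes is applied
    here because the element \<open>c\<close> below is a polynomial; \<open>c\<close> does not
    depend on \<open>p\<close>.\<close>
  define B where "B = zring (Const ` S \<union> Var ` {..N} :: (nat, 'k) mpoly set)"
  have B: "is_subring B" unfolding B_def by (rule zring_subring)
  have CB: "Const c \<in> B" if "c \<in> A" for c
  proof -
    have "is_subring {c. Const c \<in> B}"
      using B by (auto simp: is_subring_def Const_diff Const_mult)
    moreover have "S \<subseteq> {c. Const c \<in> B}"
      using zring_superset[of "Const ` S \<union> Var ` {..N}"] unfolding B_def by blast
    ultimately have "A \<subseteq> {c. Const c \<in> B}" unfolding A_def by (rule zring_minimal)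
    then show ?thesis using that by blast
  qed
  have VB: "Var v \<in> B" if "v \<le> N" for v
    unfolding B_def using zring_superset[of "Const ` S \<union> Var ` {..N}"] that by blast
  have sumB: "(\<Sum>k\<in>keys h. Const (w k) * mon Var k) \<in> B"
    if "h \<in> polyring N" "\<And>k. w k \<in> A" for h :: "(nat, 'k) mpoly" and w
    using that by (intro subring_sum[OF B] subring_mult[OF B] CB subring_mon[OF B] VB) (auto simp: polyring_def)
  have expand: "h = (\<Sum>k\<in>keys h. Const (lookup h k) * mon Var k)" for h :: "(nat, 'k) mpoly"
    using subst_Var_id[of h] by (simp add: subst_def)
  have fB: "f \<in> B"
  proof -
    have "(\<Sum>k\<in>keys f. Const (lookup f k) * mon Var k) \<in> B"
      using fA by (intro sumB[OF f(1)]) (simp add: coeffs_in_def)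
    then show ?thesis by (simp only: expand[symmetric])
  qed
  have \<delta>A: "\<delta> a \<in> A" using \<delta> A aA by (rule ipf_in_subring)
  define c where "c = Const (\<delta> a) * f"
  have "c \<in> B" unfolding c_def using CB \<delta>A fB by (intro subring_mult[OF B])
  moreover have "c \<noteq> 0" unfolding c_def using \<delta>a f(2) by simp
  moreover have "few_unit_primes B" unfolding B_def
    by (rule few_unit_primes_zring) (simp add: S_def)
  ultimately have "finite {p::nat. prime p \<and> (\<exists>M. \<exists>g\<in>B. c ^ M = of_nat p * g)}"
    unfolding few_unit_primes_def by blast
  moreover have "p \<in> {p. prime p \<and> (\<exists>M. \<exists>g\<in>B. c ^ M = of_nat p * g)}"
    \<comment> \<open>The term \<open>e * n\<close> absorbs the rounding in the choice of
      \<open>k\<close>; the summand 2 makes \<open>p\<close> odd.\<close>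
    if pr: "prime p" and big: "p > e * n + 2" for p
  proof -
    have p0: "p > 0" and odd: "odd p" using pr big by (auto simp: prime_gt_0_nat prime_odd_nat)
    \<comment> \<open>The least \<open>k\<close> with
      \<open>p * (N + m) \<le> k * n\<close>.\<close>
    define k where "k = (p * (N + m) + n - 1) div n"
    have k: "p * (N + m) \<le> k * n" "k * n < p * (N + m) + n"
    proof -
      have "(p * (N + m) + n - 1) mod n < n" using n by simp
      moreover have "k * n + (p * (N + m) + n - 1) mod n = p * (N + m) + n - 1"
        unfolding k_def by (rule div_mult_mod_eq)
      ultimately show "p * (N + m) \<le> k * n" "k * n < p * (N + m) + n" using n by linarith+
    qed
    have deg: "k * e < p * D"
    proof -
      have "n * (k * e) = e * (k * n)" by simp
      also have "\<dots> \<le> e * (p * (N + m) + n)" using k(2) by simp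
      also have "\<dots> = p * (e * (N + m)) + e * n" by (simp add: algebra_simps)
      also have "\<dots> < p * (e * (N + m)) + p" using big by simp
      also have "\<dots> = p * (e * (N + m) + 1)" by simp
      also have "\<dots> \<le> p * (n * D)" using less by (rule mult_le_mono2)
      also have "\<dots> = n * (p * D)" by simp
      finally show ?thesis by simp
    qed
    define h where "h = f ^ k"
    have hA: "h \<in> coeffs_in A" unfolding h_def using fA by (intro subring_power[OF coeffs_in_subring[OF A]])
    have hN: "h \<in> polyring N" unfolding h_def using f(1) by (intro subring_power[OF polyring_subring])
    have hh: "homogeneous (k * e) h" unfolding h_def using f(3) by (rule homogeneous_power)
    have ordh: "ord_ge (p * (N + m)) (shift (pt N a i) h)" if "i < s" for i
      using ord_ge_power[OF ord[OF that], of k] k(1) by (auto simp: h_def ord_ge_def)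
    define a' where "a' = (\<lambda>x. a x ^ p)"
    \<comment> \<open>Multiples of \<open>p\<close> within \<open>A\<close>; in the field itself
      \<open>p\<close> is invertible and the congruence would be void.\<close>
    define I where "I = (\<lambda>c. of_nat p * c) ` A"
    have I: "\<forall>x\<in>I. \<forall>y\<in>I. x - y \<in> I" "\<forall>x\<in>A. \<forall>y\<in>I. x * y \<in> I" "0 \<in> I"
    proof -
      show "\<forall>x\<in>I. \<forall>y\<in>I. x - y \<in> I"
        unfolding I_def by (auto simp flip: right_diff_distrib intro: subring_diff[OF A])
      show "\<forall>x\<in>A. \<forall>y\<in>I. x * y \<in> I"
        unfolding I_def by (auto simp: mult.left_commute[of _ "of_nat p"] intro: subring_mult[OF A])
      show "0 \<in> I" unfolding I_def using subring_0[OF A] by (intro image_eqI[of _ _ 0]) auto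
    qed
    obtain d where d: "d \<in> A" "\<delta> a' = \<delta> a ^ p + of_nat p * d"
      using ipf_frobenius[OF \<delta> A _ pr odd, of a] aA unfolding a'_def by blast
    have "\<exists>w\<in>A. \<delta> a ^ p * lookup h \<mu> = of_nat p * w" for \<mu>
    proof -
      \<comment> \<open>With \<open>b\<close> the residue of \<open>\<mu>\<close>, the coefficient
        of \<open>h\<close> at \<open>\<mu>\<close> is a coefficient of the part \<open>g\<close>,
        so every coefficient of \<open>h\<close> is reached.\<close>
      define b where "b = mmod p \<mu>"
      have b: "lookup b v < p" for v using p0 by (simp add: b_def)
      define g where "g = frob_part p b h"
      have deg': "(k * e - mdeg b) div p < D"
      proof -
        have "k * e - mdeg b < D * p" using deg by (simp add: mult.commute)
        then show ?thesis by (simp add: less_mult_imp_div_less)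
      qed
      have "\<delta> a' * lookup g (mdiv p \<mu>) \<in> I"
      proof (rule cert[unfolded forms_certificate_def, THEN conjunct2, rule_format, OF A])
        show "g \<in> polyring N" unfolding g_def using p0 hN by (rule frob_part_in_polyring)
        show "homogeneous ((k * e - mdeg b) div p) g"
          unfolding g_def using p0 hh by (rule frob_part_homogeneous)
        show "a' (i, j) \<in> A" if "i < s" "j \<le> N" for i j
          unfolding a'_def using aA[OF that] by (rule subring_power[OF A])
        fix i and \<gamma> :: "nat \<Rightarrow>\<^sub>0 nat"
        assume i: "i < s" and \<gamma>: "mdeg \<gamma> < m"
        have ptA: "pt N a i v \<in> A" for v using aA[OF i] subring_0[OF A] by (simp add: pt_def)
        have "\<exists>c\<in>A. lookup (shift (\<lambda>v. pt N a i v ^ p) (frob_part p b h)) \<gamma> = of_nat p * c"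
          by (rule frobenius_vanishing[OF A pr odd ptA hA hN ordh[OF i] _ \<gamma>]) (rule b)
        then have "lookup (shift (\<lambda>v. pt N a i v ^ p) g) \<gamma> \<in> I"
          unfolding I_def g_def by blast
        moreover have "(\<lambda>v. pt N a i v ^ p) = pt N a' i"
          using p0 by (auto simp: pt_def a'_def)
        ultimately show "lookup (shift (pt N a' i) g) \<gamma> \<in> I" by simp
      qed (use I deg' in auto)
      moreover have "lookup g (mdiv p \<mu>) = lookup h \<mu>"
        unfolding g_def b_def by (simp add: lookup_frob_part[OF p0] mmod_mdiv)
      ultimately obtain w where w: "w \<in> A" "\<delta> a' * lookup h \<mu> = of_nat p * w"
        unfolding I_def by auto
      \<comment> \<open>The certificate was evaluated at the Frobenius image \<open>a'\<close>;
        modulo \<open>p\<close> its value is a power of \<open>\<delta> a\<close>.\<close>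
      have "\<delta> a ^ p * lookup h \<mu> = of_nat p * (w - d * lookup h \<mu>)"
        using w(2) unfolding d(2) by (simp add: algebra_simps)
      moreover have "w - d * lookup h \<mu> \<in> A"
        using w d hA by (intro subring_diff[OF A] subring_mult[OF A]) (auto simp: coeffs_in_def)
      ultimately show ?thesis by blast
    qed
    then obtain w where w: "\<And>\<mu>. w \<mu> \<in> A" "\<And>\<mu>. \<delta> a ^ p * lookup h \<mu> = of_nat p * w \<mu>" by metis
    define W where "W = (\<Sum>\<mu>\<in>keys h. Const (w \<mu>) * mon Var \<mu>)"
    have "W \<in> B" unfolding W_def by (rule sumB[OF hN w(1)])
    have "Const (\<delta> a) ^ p * h = Const (\<delta> a) ^ p * (\<Sum>\<mu>\<in>keys h. Const (lookup h \<mu>) * mon Var \<mu>)"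
      by (simp only: expand[symmetric])
    also have "\<dots> = (\<Sum>\<mu>\<in>keys h. Const (\<delta> a ^ p * lookup h \<mu>) * mon Var \<mu>)"
      by (simp add: sum_distrib_left Const_mult Const_power mult.assoc)
    also have "\<dots> = of_nat p * W"
      by (simp add: W_def w(2) sum_distrib_left Const_mult Const_of_nat mult.assoc)
    finally have "c ^ (p + k) = of_nat p * (W * (Const (\<delta> a) ^ k * f ^ p))"
      by (simp add: c_def h_def power_mult_distrib power_add algebra_simps)
    moreover have "W * (Const (\<delta> a) ^ k * f ^ p) \<in> B"
      using \<open>W \<in> B\<close> CB[OF \<delta>A] fB by (intro subring_mult[OF B] subring_power[OF B])
    ultimately show ?thesis using pr by blast
  qed
  ultimately have "finite {p::nat. prime p \<and> p > e * n + 2}"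
    by (elim finite_subset[rotated]) blast
  then have "finite ({p::nat. prime p \<and> p > e * n + 2} \<union> {..e * n + 2})" by simp
  then have "finite {p::nat. prime p}" by (rule rev_finite_subset) auto
  then show False using primes_infinite by blast
qed

subsection \<open>Point ideals and their powers\<close>

lemma ideal_span_base: "g \<in> S \<Longrightarrow> g \<in> ideal_span N S"
  unfolding ideal_span_def
  by (rule CollectI, rule exI[of _ "{g}"], rule exI[of _ "\<lambda>_. 1"]) (simp add: subring_1[OF polyring_subring])

lemma ideal_span_0: "0 \<in> ideal_span N S"
  unfolding ideal_span_def by (rule CollectI, rule exI[of _ "{}"]) simp

lemma ideal_span_mult:
  assumes "f \<in> ideal_span N S" "q \<in> polyring N"
  shows "q * f \<in> ideal_span N S"
proof -
  obtain F r where F: "f = (\<Sum>g\<in>F. r g * g)" "finite F" "F \<subseteq> S" "\<forall>g\<in>F. r g \<in> polyring N"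
    using assms(1) unfolding ideal_span_def by blast
  show ?thesis
    unfolding ideal_span_def
    using F assms(2)
    by (intro CollectI exI[of _ F] exI[of _ "\<lambda>g. q * r g"])
      (auto simp: sum_distrib_left mult.assoc intro: subring_mult[OF polyring_subring])
qed

lemma ideal_span_add:
  assumes "f \<in> ideal_span N S" "f' \<in> ideal_span N S"
  shows "f + f' \<in> ideal_span N S"
proof -
  obtain F r where F: "f = (\<Sum>g\<in>F. r g * g)" "finite F" "F \<subseteq> S" "\<forall>g\<in>F. r g \<in> polyring N"
    using assms(1) unfolding ideal_span_def by blast
  obtain F' r' where F': "f' = (\<Sum>g\<in>F'. r' g * g)" "finite F'" "F' \<subseteq> S" "\<forall>g\<in>F'. r' g \<in> polyring N"
    using assms(2) unfolding ideal_span_def by blast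
  define q where "q g = (if g \<in> F then r g else 0)" for g
  define q' where "q' g = (if g \<in> F' then r' g else 0)" for g
  have "f = (\<Sum>g\<in>F \<union> F'. q g * g)" "f' = (\<Sum>g\<in>F \<union> F'. q' g * g)"
    unfolding F F' using F(2) F'(2) by (auto simp: q_def q'_def intro!: sum.mono_neutral_cong_left)
  then have "f + f' = (\<Sum>g\<in>F \<union> F'. (q g + q' g) * g)"
    by (simp add: distrib_right sum.distrib)
  moreover have "q g + q' g \<in> polyring N" for g
    using F(4) F'(4) subring_0[OF polyring_subring, of N]
    by (intro subring_add[OF polyring_subring]) (auto simp: q_def q'_def)
  ultimately show ?thesis
    unfolding ideal_span_def using F(2,3) F'(2,3)
    by (intro CollectI exI[of _ "F \<union> F'"] exI[of _ "\<lambda>g. q g + q' g"]) auto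
qed

lemma ideal_span_sum: "(\<And>i. i \<in> X \<Longrightarrow> f i \<in> ideal_span N S) \<Longrightarrow> sum f X \<in> ideal_span N S"
  by (induction X rule: infinite_finite_induct) (simp_all add: ideal_span_0 ideal_span_add)

lemma ideal_span_induct [consumes 1, case_names generator zero add]:
  assumes f: "f \<in> ideal_span N S"
    and "\<And>r g. g \<in> S \<Longrightarrow> r \<in> polyring N \<Longrightarrow> Q (r * g)" "Q 0" "\<And>f g. Q f \<Longrightarrow> Q g \<Longrightarrow> Q (f + g)"
  shows "Q f"
proof -
  obtain F r where F: "f = (\<Sum>g\<in>F. r g * g)" "finite F" "F \<subseteq> S" "\<forall>g\<in>F. r g \<in> polyring N"
    using f unfolding ideal_span_def by blast
  show ?thesis
    unfolding F(1) using F(2-) by (induction F) (simp_all add: assms)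
qed

lemma ideal_span_in_polyring:
  assumes "f \<in> ideal_span N S" "S \<subseteq> polyring N"
  shows "f \<in> polyring N"
  using assms(1)
  by (induction rule: ideal_span_induct)
    (use assms(2) in \<open>auto intro: subring_mult[OF polyring_subring] subring_add[OF polyring_subring] subring_0[OF polyring_subring]\<close>)

lemma point_ideal_in_polyring: "point_ideal N p \<subseteq> polyring N"
  unfolding point_ideal_def
  by (auto elim!: ideal_span_in_polyring
      intro!: subring_diff[OF polyring_subring] subring_mult[OF polyring_subring] Var_in_polyring)

lemma ideal_pow_in_polyring:
  assumes "f \<in> ideal_pow N (point_ideal N p) m"
  shows "f \<in> polyring N"
  using assms unfolding ideal_pow_def
proof (rule ideal_span_in_polyring)
  have "prod_list gs \<in> polyring N" if "set gs \<subseteq> point_ideal N p" for gs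
    using that point_ideal_in_polyring[of N p]
    by (induction gs) (auto intro: subring_1[OF polyring_subring] subring_mult[OF polyring_subring])
  then show "{prod_list gs |gs. length gs = m \<and> set gs \<subseteq> point_ideal N p} \<subseteq> polyring N" by blast
qed

text \<open>The minors are unchanged by translation along the point itself, so they remain linear
  forms after the shift.\<close>

lemma point_ideal_ord_ge:
  assumes "f \<in> point_ideal N (\<lambda>j. a (i, j))"
  shows "ord_ge 1 (shift (pt N a i) f)"
  using assms unfolding point_ideal_def
proof (induction rule: ideal_span_induct)
  case (generator r g)
  then obtain j k where g: "g = Const (a (i, j)) * Var k - Const (a (i, k)) * Var j" "j \<le> N" "k \<le> N" by blast
  have "shift (pt N a i) g = g"
    unfolding g(1) using g(2,3) by (simp add: pt_def algebra_simps)
  moreover have "homogeneous 1 g"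
    unfolding g(1) by (intro homogeneous_diff homogeneous_Const_mult homogeneous_Var)
  ultimately have "ord_ge 1 (shift (pt N a i) g)" by (simp add: ord_ge_homogeneous)
  then show ?case by (simp add: ord_ge_mult_left)
qed (simp_all add: ord_ge_add)

lemma ideal_pow_ord_ge:
  assumes "f \<in> ideal_pow N (point_ideal N (\<lambda>j. a (i, j))) m"
  shows "ord_ge m (shift (pt N a i) f)"
  using assms unfolding ideal_pow_def
proof (induction rule: ideal_span_induct)
  case (generator r g)
  then obtain gs where gs: "g = prod_list gs" "length gs = m" "set gs \<subseteq> point_ideal N (\<lambda>j. a (i, j))" by blast
  have "ord_ge (length gs) (shift (pt N a i) (prod_list gs))" using gs(3)
  proof (induction gs)
    case (Cons g gs)
    then show ?case
      using ord_ge_mult[OF point_ideal_ord_ge[of g N a i], of "length gs" "shift (pt N a i) (prod_list gs)"] by simp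
  qed simp
  then show ?case using gs by (simp add: ord_ge_mult_left)
qed (simp_all add: ord_ge_add)

lemma mpoly_eval_eq: "mpoly_eval f p = (\<Sum>m\<in>keys f. lookup f m * mon p m)"
  by (simp add: mpoly_eval_def mon_def)

lemma mpoly_eval_mon: "mpoly_eval (mon Var m) p = mon p m"
  by (subst Const_eq_iff[symmetric]) (simp add: Const_mpoly_eval subst_mon mon_Const)

text \<open>Modulo the minors, \<open>p N\<close> times \<open>Var v\<close> equals
  \<open>p v\<close> times \<open>Var N\<close>, so \<open>p N ^ d\<close> times \<open>f\<close> is
  congruent to the value of \<open>f\<close> at \<open>p\<close> times \<open>Var N ^ d\<close>, and
  \<open>p N ^ d\<close> is invertible.\<close>

lemma vanishing_in_point_ideal:
  fixes p :: "nat \<Rightarrow> 'k::field"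
  assumes f: "f \<in> polyring N" "homogeneous d f" and p: "p N \<noteq> 0" and z: "mpoly_eval f p = 0"
  shows "f \<in> point_ideal N p"
proof -
  let ?J = "point_ideal N p"
  have J_mult: "q * g \<in> ?J" if "g \<in> ?J" "q \<in> polyring N" for q g
    using that unfolding point_ideal_def by (rule ideal_span_mult)
  have J_add: "g + h \<in> ?J" if "g \<in> ?J" "h \<in> ?J" for g h
    using that unfolding point_ideal_def by (rule ideal_span_add)
  have gen: "Const (p N) * Var v - Const (p v) * Var N \<in> ?J" if "v \<le> N" for v
    unfolding point_ideal_def using that by (intro ideal_span_base) blast
  have mono: "Const (p N ^ mdeg m) * mon Var m - Const (mon p m) * Var N ^ mdeg m \<in> ?J"
    if "keys m \<subseteq> {..N}" for m
    using that
  proof (induction m rule: monomial_induct_in)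
    case zero
    show ?case by (simp add: point_ideal_def ideal_span_0)
  next
    case (add v n)
    let ?A = "Const (p N ^ mdeg n) * mon Var n - Const (mon p n) * Var N ^ mdeg n"
    let ?B = "Const (p N) * Var v - Const (p v) * Var N :: (nat, 'k) mpoly"
    have "Const (p N ^ mdeg (single v 1 + n)) * mon Var (single v 1 + n)
        - Const (mon p (single v 1 + n)) * Var N ^ mdeg (single v 1 + n)
      = (Const (p N) * Var v) * ?A + (Const (mon p n) * Var N ^ mdeg n) * ?B"
      by (simp add: Const_mult algebra_simps)
    moreover have "(Const (p N) * Var v) * ?A \<in> ?J"
      using add by (intro J_mult subring_mult[OF polyring_subring] Var_in_polyring) auto
    moreover have "(Const (mon p n) * Var N ^ mdeg n) * ?B \<in> ?J"
      using add by (intro J_mult gen subring_mult[OF polyring_subring] subring_power[OF polyring_subring] Var_in_polyring) auto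
    ultimately show ?case using J_add by simp
  qed
  have "(\<Sum>m\<in>keys f. Const (lookup f m) * (Const (p N ^ mdeg m) * mon Var m - Const (mon p m) * Var N ^ mdeg m)) \<in> ?J"
    unfolding point_ideal_def
  proof (intro ideal_span_sum ideal_span_mult Const_in_polyring mono[unfolded point_ideal_def])
    fix m assume "m \<in> keys f"
    then show "keys m \<subseteq> {..N}" using f(1) by (auto simp: polyring_def)
  qed
  also have "(\<Sum>m\<in>keys f. Const (lookup f m) * (Const (p N ^ mdeg m) * mon Var m - Const (mon p m) * Var N ^ mdeg m))
    = (\<Sum>m\<in>keys f. Const (p N ^ d) * (Const (lookup f m) * mon Var m) - Const (lookup f m * mon p m) * Var N ^ d)"
    using f(2) by (intro sum.cong) (auto simp: homogeneous_iff Const_mult algebra_simps)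
  also have "\<dots> = Const (p N ^ d) * subst Var f - Const (mpoly_eval f p) * Var N ^ d"
    by (simp only: sum_subtractf mpoly_eval_eq Const_sum subst_def sum_distrib_left sum_distrib_right)
  also have "\<dots> = Const (p N ^ d) * f" using z by simp
  finally have "Const (p N ^ d) * f \<in> ?J" .
  then have "Const (inverse (p N ^ d)) * (Const (p N ^ d) * f) \<in> ?J" by (rule J_mult) (rule Const_in_polyring)
  moreover have "Const (inverse (p N ^ d)) * (Const (p N ^ d) * f) = f"
    using p by (simp add: mult.assoc[symmetric] Const_mult[symmetric])
  ultimately show ?thesis by (simp only:)
qed

section \<open>Dimension counts and the least degree of a form\<close>

lemma underdetermined_system:
  fixes c :: "nat \<Rightarrow> 'x \<Rightarrow> 'k::field"
  assumes "finite X" "s < card X"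
  shows "\<exists>v. (\<exists>x\<in>X. v x \<noteq> 0) \<and> (\<forall>i<s. (\<Sum>x\<in>X. c i x * v x) = 0)"
  using assms
proof (induction s arbitrary: X c)
  case 0
  then show ?case by (intro exI[of _ "\<lambda>_. 1"]) (auto simp: card_gt_0_iff)
next
  case (Suc s)
  show ?case
  proof (cases "\<forall>x\<in>X. c s x = 0")
    case True
    obtain v where "\<exists>x\<in>X. v x \<noteq> 0" "\<forall>i<s. (\<Sum>x\<in>X. c i x * v x) = 0"
      using Suc.IH[of X c] Suc.prems by auto
    then show ?thesis using True by (auto simp: less_Suc_eq)
  next
    case False
    then obtain y where y: "y \<in> X" "c s y \<noteq> 0" by blast
    let ?Y = "X - {y}"
    have Y: "finite ?Y" "s < card ?Y" using Suc.prems y by auto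
    obtain v where v: "\<exists>x\<in>?Y. v x \<noteq> 0" "\<forall>i<s. (\<Sum>x\<in>?Y. (c i x - c i y * c s x / c s y) * v x) = 0"
      using Suc.IH[OF Y, of "\<lambda>i x. c i x - c i y * c s x / c s y"] by blast
    define w where "w x = (if x = y then - (\<Sum>x\<in>?Y. c s x * v x) / c s y else v x)" for x
    have "(\<Sum>x\<in>X. c i x * w x) = (\<Sum>x\<in>?Y. (c i x - c i y * c s x / c s y) * v x)" for i
    proof -
      have "(\<Sum>x\<in>X. c i x * w x) = c i y * w y + (\<Sum>x\<in>?Y. c i x * w x)"
        using Suc.prems y by (simp add: sum.remove)
      also have "(\<Sum>x\<in>?Y. c i x * w x) = (\<Sum>x\<in>?Y. c i x * v x)"
        by (intro sum.cong) (auto simp: w_def)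
      also have "c i y * w y = - (\<Sum>x\<in>?Y. c i y * c s x / c s y * v x)"
        by (simp add: w_def sum_divide_distrib sum_distrib_left mult.assoc flip: sum_negf)
      finally show ?thesis by (simp add: left_diff_distrib sum_subtractf)
    qed
    moreover have "(\<Sum>x\<in>?Y. (c s x - c s y * c s x / c s y) * v x) = 0" using y by simp
    moreover have "\<exists>x\<in>X. w x \<noteq> 0" using v(1) by (auto simp: w_def)
    ultimately show ?thesis using v(2) by (intro exI[of _ w]) (auto simp: less_Suc_eq)
  qed
qed

text \<open>Stars and bars: lists of \<open>N + 1\<close> exponents with sum \<open>d\<close> inject
  into the monomials of degree \<open>d\<close>.\<close>

lemma card_monomials_ge:
  "(N + d) choose d \<le> card {m :: nat \<Rightarrow>\<^sub>0 nat. keys m \<subseteq> {..N} \<and> mdeg m = d}"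
proof -
  let ?L = "{l :: nat list. size l = Suc N \<and> sum_list l = d}"
  let ?M = "{m :: nat \<Rightarrow>\<^sub>0 nat. keys m \<subseteq> {..N} \<and> mdeg m = d}"
  have "(N + d) choose d = card ?L"
    by (simp add: card_length_sum_list add.commute)
  also have "\<dots> \<le> card ?M"
  proof (rule card_inj_on_le)
    show "inj_on Poly_Mapping.nth ?L"
    proof (rule inj_onI)
      fix k l assume "k \<in> ?L" "l \<in> ?L" "Poly_Mapping.nth k = Poly_Mapping.nth l"
      then show "k = l"
        by (intro nth_equalityI) (auto simp: poly_mapping_eq_iff fun_eq_iff nth_default_def, metis)
    qed
    show "Poly_Mapping.nth ` ?L \<subseteq> ?M"
    proof (rule image_subsetI)
      fix l assume "l \<in> ?L"
      then have l: "size l = Suc N" "sum_list l = d" by simp_all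
      have keys: "keys (Poly_Mapping.nth l) \<subseteq> {..N}"
      proof
        fix v assume "v \<in> keys (Poly_Mapping.nth l)"
        then have "lookup (Poly_Mapping.nth l) v \<noteq> 0" by (rule in_keys_iff[THEN iffD1])
        then show "v \<in> {..N}" using l(1) by (auto simp: nth_default_def split: if_splits)
      qed
      then have "mdeg (Poly_Mapping.nth l) = (\<Sum>j\<le>N. lookup (Poly_Mapping.nth l) j)"
        by (intro mdeg_superset) auto
      also have "\<dots> = (\<Sum>j\<in>{0..<Suc N}. l ! j)"
        using l by (intro sum.cong) (auto simp: nth_default_def)
      also have "\<dots> = d" using l by (simp only: sum_list_sum_nth)
      finally show "Poly_Mapping.nth l \<in> ?M" using keys by (simp only: mem_Collect_eq)
    qed
    show "finite ?M"
      by (rule finite_subset[OF _ finite_monomials[of "{..N}" d]]) auto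
  qed
  finally show ?thesis .
qed

text \<open>There are more monomials of degree \<open>d\<close> than points, so some nonzero form of
  degree \<open>d\<close> vanishes at all of them.\<close>

lemma alpha_points_ideal_le:
  fixes a :: "nat \<times> nat \<Rightarrow> 'k::field"
  assumes a: "\<And>i. i < s \<Longrightarrow> a (i, N) \<noteq> 0" and s: "s < (N + d) choose d"
  shows "alpha (points_ideal N s a) \<le> d"
proof -
  let ?M = "{m :: nat \<Rightarrow>\<^sub>0 nat. keys m \<subseteq> {..N} \<and> mdeg m = d}"
  have fM: "finite ?M"
    by (rule finite_subset[OF _ finite_monomials[of "{..N}" d]]) auto
  have "s < card ?M" using s card_monomials_ge[of N d] by simp
  from underdetermined_system[OF fM this, of "\<lambda>i m. mon (\<lambda>j. a (i, j)) m"]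
  obtain v where v: "\<exists>m\<in>?M. v m \<noteq> 0" "\<forall>i<s. (\<Sum>m\<in>?M. mon (\<lambda>j. a (i, j)) m * v m) = 0" by blast
  define f where "f = (\<Sum>m\<in>?M. single m (v m))"
  have lf: "lookup f k = (if k \<in> ?M then v k else 0)" for k
    unfolding f_def lookup_sum lookup_single when_def using fM by simp
  have "f \<noteq> 0" using v(1) lf by (metis lookup_zero)
  have "k \<in> ?M" if "k \<in> keys f" for k
    using that unfolding in_keys_iff lf by (simp split: if_splits)
  then have fN: "f \<in> polyring N" and fd: "homogeneous d f"
    by (auto simp: polyring_def homogeneous_iff)
  have "mpoly_eval f (\<lambda>j. a (i, j)) = 0" if "i < s" for i
    using v(2) that by (simp add: f_def single_eq_Const_mon mpoly_eval_mon mult.commute)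
  then have "f \<in> points_ideal N s a"
    unfolding points_ideal_def using vanishing_in_point_ideal[OF fN fd] a by auto
  then show ?thesis
    unfolding alpha_def using \<open>f \<noteq> 0\<close> fd by (intro Least_le) blast
qed

text \<open>\<open>LEAST\<close> says something only if a form exists; the \<open>m\<close>-th power
  of a product with one linear form through each point is one.\<close>

lemma alpha_symbolic_power_attained:
  fixes a :: "nat \<times> nat \<Rightarrow> 'k::field"
  assumes a: "\<And>i. i < s \<Longrightarrow> a (i, N) \<noteq> 0" and N: "N \<ge> 1"
  obtains f where "f \<in> symbolic_power N s a m" "f \<noteq> 0" "homogeneous (alpha (symbolic_power N s a m)) f"
proof -
  define l where "l i = Const (a (i, N)) * Var 0 - Const (a (i, 0)) * Var N" for i
  have l: "l i \<in> point_ideal N (\<lambda>j. a (i, j))" for i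
    unfolding point_ideal_def l_def by (intro ideal_span_base) blast
  have l1: "homogeneous 1 (l i)" for i
    unfolding l_def by (intro homogeneous_diff homogeneous_Const_mult homogeneous_Var)
  have l0: "l i \<noteq> 0" if "i < s" for i
  proof
    assume "l i = 0"
    then have "mpoly_eval (l i) (\<lambda>v. if v = 0 then 1 else 0) = 0" by simp
    then show False using a[OF that] N by (simp add: l_def)
  qed
  define f where "f = (\<Prod>i<s. l i) ^ m"
  have "f \<noteq> 0" unfolding f_def using l0 by simp
  have "homogeneous (card {..<s}) (\<Prod>i<s. l i)" by (rule homogeneous_prod) (simp, rule l1)
  then have fh: "homogeneous (m * card {..<s}) f" unfolding f_def by (rule homogeneous_power)
  have "f \<in> ideal_pow N (point_ideal N (\<lambda>j. a (i, j))) m" if i: "i < s" for i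
  proof -
    have "(\<Prod>i<s. l i) = l i * (\<Prod>j\<in>{..<s} - {i}. l j)" using i by (simp add: prod.remove)
    then have "f = (\<Prod>j\<in>{..<s} - {i}. l j) ^ m * prod_list (replicate m (l i))"
      by (simp add: f_def power_mult_distrib mult.commute)
    moreover have "prod_list (replicate m (l i)) \<in> ideal_pow N (point_ideal N (\<lambda>j. a (i, j))) m"
      unfolding ideal_pow_def using l by (intro ideal_span_base CollectI exI[of _ "replicate m (l i)"]) auto
    moreover have "(\<Prod>j\<in>{..<s} - {i}. l j) ^ m \<in> polyring N"
      using l point_ideal_in_polyring by (intro subring_power[OF polyring_subring] subring_prod[OF polyring_subring]) blast
    ultimately show ?thesis unfolding ideal_pow_def by (simp add: ideal_span_mult)
  qed
  then have "f \<in> symbolic_power N s a m" by (simp add: symbolic_power_def)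
  then have "\<exists>d. \<exists>f\<in>symbolic_power N s a m. f \<noteq> 0 \<and> homogeneous d f"
    using fh \<open>f \<noteq> 0\<close> by blast
  from LeastI_ex[OF this] show ?thesis unfolding alpha_def using that[unfolded alpha_def] by blast
qed

section \<open>From star configurations to general points\<close>

lemma star_points_no_forms_below:
  assumes N: "N \<ge> 1" "N \<le> L" and s: "L choose N \<le> s"
  shows "\<exists>b :: nat \<times> nat \<Rightarrow> 'k::field_char_0.
    no_forms_below s N (N * L) (L * L) b \<and> (\<forall>i<s. b (i, N) = 1)"
proof -
  define T where "T = (of_nat ` {..<L} :: 'k set)"
  have T: "finite T" "card T = L"
    unfolding T_def by (simp_all add: card_image inj_on_def)
  define SS where "SS = {S. S \<subseteq> T \<and> card S = N}"
  have SS: "finite SS" "card SS = L choose N"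
    using n_subsets[OF T(1), of N] T by (simp_all add: SS_def)
  obtain h where h: "bij_betw h {0..<card SS} SS" using ex_bij_betw_nat_finite[OF SS(1)] by blast
  have pos: "0 < card SS" using N SS(2) by simp
  \<comment> \<open>If there are fewer star points than \<open>s\<close>, the remaining indices
    repeat the first one.\<close>
  define g where "g i = h (if i < card SS then i else 0)" for i
  have gSS: "g i \<in> SS" for i
    unfolding g_def using pos by (intro bij_betw_apply[OF h]) simp
  then have g: "card (g i) = N" for i by (simp add: SS_def)
  have surj: "\<exists>i<s. g i = S" if "S \<in> SS" for S
  proof -
    have "S \<in> h ` {0..<card SS}" using that bij_betw_imp_surj_on[OF h] by simp
    then obtain i where "i < card SS" "h i = S" by auto
    then show ?thesis using s SS(2) by (intro exI[of _ i]) (simp add: g_def)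
  qed
  define b where "b = (\<lambda>(i, j). star_pt (g i) j)"
  have pt_b: "pt N b i = star_pt (g i)" for i
  proof
    fix j
    have "star_pt (g i) j = 0" if "j > N"
      unfolding star_pt_def using g[of i] that by (intro coeff_eq_0) (simp add: degree_star)
    then show "pt N b i j = star_pt (g i) j" by (simp add: pt_def b_def)
  qed
  have "no_forms_below s N (N * L) (L * L) b"
    unfolding no_forms_below_def
  proof (intro ballI allI impI)
    fix f e assume f: "f \<in> polyring N" "homogeneous e f" "e < L * L"
      and ord: "\<forall>i<s. ord_ge (N * L) (shift (pt N b i) f)"
    show "f = 0"
    proof (rule star_configuration[OF N(1) T(1) _ f(1,2)])
      show "N \<le> card T" using N T by simp
      show "N * e < N * L * card T" using N f(3) T(2) by (simp add: mult.assoc)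
      fix S assume "S \<subseteq> T" "card S = N"
      then show "ord_ge (N * L) (shift (star_pt S) f)" using surj[of S] ord pt_b by (auto simp: SS_def)
    qed
  qed
  \<comment> \<open>The last coordinate is the leading coefficient of a monic polynomial of degree
    \<open>N\<close>.\<close>
  moreover have "b (i, N) = 1" for i
    using g[of i] lead_coeff_prod[of "\<lambda>s. [:-s, 1:]" "g i"] degree_star[of "g i"]
    by (simp add: b_def star_pt_def)
  ultimately show ?thesis by blast
qed

theorem theorem5p8:
  fixes N s :: nat
  assumes "N \<ge> 3" and "s \<ge> 1"
  shows "\<exists>U :: (nat \<times> nat \<Rightarrow> 'k::field_char_0) set.
           param_zariski_open N s U \<and> U \<noteq> {} \<and>
           (\<forall>a\<in>U. \<forall>m::nat. m \<ge> 1 \<longrightarrow>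
              real (alpha (symbolic_power N s a m)) / real m
                \<ge> (real (alpha (points_ideal N s a)) + real N - 2) / real N)"
proof -
  have N: "N \<ge> 1" using assms by simp
  have "s < (N + s) choose s"
  proof -
    have "(1 + s) choose s \<le> (N + s) choose s" using N by (intro binomial_right_mono) simp
    then show ?thesis by simp
  qed
  then have ex: "\<exists>d. s < (N + d) choose d" by blast
  \<comment> \<open>There are enough monomials of degree \<open>d\<close> to give
    \<open>alpha \<le> d\<close>, while minimality leaves at most \<open>s\<close> star points for
    \<open>L = N + (d - 1)\<close>.\<close>
  define d where "d = (LEAST d. s < (N + d) choose d)"
  have sd: "s < (N + d) choose d" unfolding d_def using ex by (rule LeastI_ex)
  have d: "d \<ge> 1" using sd assms by (cases d) auto
  have sd': "(N + (d - 1)) choose (d - 1) \<le> s"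
    using not_less_Least[of "d - 1" "\<lambda>d. s < (N + d) choose d"] d by (simp add: d_def[symmetric])
  define L where "L = N + (d - 1)"
  have L: "N \<le> L" "L \<ge> 1" using N by (simp_all add: L_def)
  have "L choose N \<le> s" using sd' binomial_symmetric[of N L] by (simp add: L_def)
  from star_points_no_forms_below[OF N L(1) this]
  obtain b :: "nat \<times> nat \<Rightarrow> 'k" where b: "no_forms_below s N (N * L) (L * L) b" "\<forall>i<s. b (i, N) = 1"
    by blast
  obtain \<delta> where \<delta>: "forms_certificate s N (N * L) (L * L) \<delta>" "\<delta> b \<noteq> 0"
    using no_forms_below_certificate[OF b(1)] by blast
  \<comment> \<open>The extra factor keeps the last coordinates nonzero, as both facts about
    \<open>alpha\<close> require.\<close>
  have "(\<lambda>a. \<delta> a * (\<Prod>i<s. a (i, N))) \<in> ipf s N"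
    using \<delta>(1) by (intro ipf.mult ipf_prod ipf.var) (auto simp: forms_certificate_def)
  then obtain P where P: "\<forall>m\<in>keys P. keys m \<subseteq> {..<s} \<times> {..N}"
    "\<And>a. mpoly_eval P a = \<delta> a * (\<Prod>i<s. a (i, N))"
    using ipf_mpoly_eval by blast
  let ?U = "{a. mpoly_eval P a \<noteq> 0}"
  show ?thesis
  proof (intro exI[of _ ?U] conjI ballI allI impI)
    show "param_zariski_open N s ?U"
      unfolding param_zariski_open_def using P(1) by (intro exI[of _ "{P}"]) auto
    have "b \<in> ?U" using \<delta>(2) b(2) by (simp add: P(2))
    then show "?U \<noteq> {}" by blast
  next
    fix a :: "nat \<times> nat \<Rightarrow> 'k" and m :: nat
    assume "a \<in> ?U" and m: "m \<ge> 1"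
    then have a: "\<delta> a \<noteq> 0" "\<And>i. i < s \<Longrightarrow> a (i, N) \<noteq> 0" by (auto simp: P(2))
    let ?e = "alpha (symbolic_power N s a m)" and ?\<alpha> = "alpha (points_ideal N s a)"
    obtain f where f: "f \<in> symbolic_power N s a m" "f \<noteq> 0" "homogeneous ?e f"
      by (rule alpha_symbolic_power_attained[where a = a and s = s and N = N and m = m]) (use a(2) N in auto)
    have f_pow: "f \<in> ideal_pow N (point_ideal N (\<lambda>j. a (i, j))) m" if "i < s" for i
      using f(1) that by (simp add: symbolic_power_def)
    have "f \<in> polyring N" using f_pow[of 0] assms by (auto intro: ideal_pow_in_polyring)
    from degree_lower_bound[OF \<delta>(1) a(1) this f(2,3) m ideal_pow_ord_ge[OF f_pow]]
    have "m * (L * L) \<le> ?e * (N + N * L)" by simp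
    then have "real (m * (L * L)) \<le> real (?e * (N + N * L))" by (rule of_nat_mono)
    then have *: "real m * (real L * real L) \<le> real ?e * (real N * (1 + real L))"
      by (simp add: algebra_simps)
    have "?\<alpha> \<le> d" using a(2) sd by (rule alpha_points_ideal_le)
    then have "real ?\<alpha> + real N - 2 \<le> real L - 1" using d by (simp add: L_def of_nat_diff)
    then have "(real ?\<alpha> + real N - 2) / real N \<le> (real L - 1) / real N"
      by (rule divide_right_mono) simp
    \<comment> \<open>Expanding by \<open>1 + real L\<close> makes the numerator the square of
      \<open>L\<close> minus 1, just below the square of \<open>L\<close> in the degree
      bound.\<close>
    also have "\<dots> = (real L - 1) * (1 + real L) / (real N * (1 + real L))"
      by (intro mult_divide_mult_cancel_right[symmetric]) linarith
    also have "\<dots> \<le> real L * real L / (real N * (1 + real L))"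
      by (rule divide_right_mono) (simp_all add: algebra_simps)
    also have "\<dots> \<le> real ?e / real m"
    proof -
      have "0 < real N * (1 + real L)" using N by (simp add: add_pos_nonneg)
      moreover have "real L * real L \<le> real ?e * (real N * (1 + real L)) / real m"
        using * m by (simp add: pos_le_divide_eq mult.commute)
      ultimately show ?thesis by (simp add: pos_divide_le_eq)
    qed
    finally show "(real ?\<alpha> + real N - 2) / real N \<le> real ?e / real m" .
  qed
qed

end
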